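(* Let $\mathcal{H}$ be a real Hilbert space and let $u^*\in\mathcal{H}$ be a local minimizer of a twice continuously Fréchet differentiable function $\mathcal{F}:\mathcal{H}\to\mathbb{R}$ with locally Lipschitz continuous second derivative. Suppose that there are constants $\delta_{\sup}\ge\delta_{\inf}>0$ such that $$\delta_{\inf}\|v\|^2\le\mathcal{F}''(u^* )(v,v)\le\delta_{\sup}\|v\|^2\quad\text{for all }v\in\mathcal{H}.$$ Then there exist positive constants $\zeta,\lambda_1,\lambda_2$ and $\theta<1$ such that for all initial iterates $u_0,u_1\in\mathcal{B}_\zeta(u^* )$ with $u_0\ne u_1$, the sequence $\{u_k\}_k$ generated by the Barzilai-Borwein (BB) gradient algorithm satisfies $$\|u_k-u^*\|\le\lambda_1\theta^k\|u_1-u^*\|\quad\text{for all }k\ge1$$ and $$\|\mathcal{G}_k\|\le\lambda_2\theta^k\|\mathcal{G}_1\|\quad\text{for all }k\ge1.$$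
   Context: $(\cdot,\cdot)$ and $\|\cdot\|$ are the inner product and norm of $\mathcal{H}$; $\mathcal{B}_\zeta(u^* )$ is the ball of radius $\zeta$ centered at $u^*$. $\mathcal{G}:\mathcal{H}\to\mathcal{H}$ is the gradient of $\mathcal{F}$, i.e. the Riesz representative of the derivative: $\mathcal{F}'(u)\delta u=(\mathcal{G}(u),\delta u)$; and $\mathcal{G}_k:=\mathcal{G}(u_k)$. BB gradient algorithm (with two initial iterates $u_0\ne u_1$): for $k=1,2,\dots$: if $\mathcal{G}_k=0$ stop; otherwise choose $\alpha_k$ equal to either $$\alpha_k^{BB1}=\frac{(\mathcal{S}_{k-1},\mathcal{Y}_{k-1})}{(\mathcal{S}_{k-1},\mathcal{S}_{k-1})}\quad\text{or}\quad \alpha_k^{BB2}=\frac{(\mathcal{Y}_{k-1},\mathcal{Y}_{k-1})}{(\mathcal{S}_{k-1},\mathcal{Y}_{k-1})},$$ where $\mathcal{S}_{k-1}=u_k-u_{k-1}$, $\mathcal{Y}_{k-1}=\mathcal{G}_k-\mathcal{G}_{k-1}$ (the choice may be made arbitrarily at each iteration), and set $u_{k+1}=u_k-\frac{1}{\alpha_k}\mathcal{G}_k$. If the algorithm stops at index $k$, the sequence is understood as continued by $u_j=u_k$ for $j\ge k$. *)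

theory Defs
  imports "HOL-Analysis.Analysis"
begin

(* The Riesz representative of the Frechet derivative; lemma GDERIV_gradient below shows that
   it is well defined wherever the function is differentiable. *)
definition gradient :: "('a::real_inner \<Rightarrow> real) \<Rightarrow> 'a \<Rightarrow> 'a" where
  "gradient F x = (THE g. GDERIV F x :> g)"

lemma riesz_representation:
  fixes f :: "'a::{real_inner, complete_space} \<Rightarrow> real"
  assumes "bounded_linear f"
  shows "\<exists>g. \<forall>h. f h = inner h g"
proof -
  interpret f: bounded_linear f by fact
  define J where "J v = inner v v - 2 * f v" for v
  obtain K where K: "\<And>v. norm (f v) \<le> norm v * K" using f.bounded by blast
  have lower: "- (K\<^sup>2) \<le> J v" for v
  proof -
    have "f v \<le> norm v * K" using K[of v] by simp
    moreover have "0 \<le> (norm v - K)\<^sup>2" by simp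
    ultimately show ?thesis
      by (simp add: J_def power2_norm_eq_inner[symmetric] power2_diff)
  qed
  have bdd: "bdd_below (range J)" using lower by (auto intro!: bdd_belowI)
  define m where "m = Inf (range J)"
  have m_le: "m \<le> J v" for v unfolding m_def by (rule cInf_lower[OF _ bdd]) auto
  have "\<exists>v. J v < m + inverse (real (Suc n))" for n
    using cInf_lessD[of "range J" "m + inverse (real (Suc n))"] by (auto simp: m_def)
  then obtain v where v: "\<And>n. J (v n) < m + inverse (real (Suc n))" by metis
  have par: "(norm (x - y))\<^sup>2 \<le> 2 * (J x + J y - 2 * m)" for x y
  proof -
    have "(norm (x - y))\<^sup>2 = 2 * (J x + J y - 2 * J ((1/2) *\<^sub>R (x + y)))"
      unfolding J_def power2_norm_eq_inner
      by (simp add: f.add f.scaleR inner_simps inner_commute algebra_simps)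
    also have "\<dots> \<le> 2 * (J x + J y - 2 * m)" using m_le by simp
    finally show ?thesis .
  qed
  have "Cauchy v"
  proof (rule metric_CauchyI)
    fix e :: real assume "0 < e"
    then have "0 < e\<^sup>2 / 4" by simp
    then obtain N where N: "inverse (real (Suc N)) < e\<^sup>2 / 4" using reals_Archimedean by blast
    have "dist (v i) (v j) < e" if "i \<ge> N" "j \<ge> N" for i j
    proof -
      have "inverse (real (Suc i)) \<le> inverse (real (Suc N))"
        "inverse (real (Suc j)) \<le> inverse (real (Suc N))"
        using that by (auto intro!: le_imp_inverse_le)
      with v[of i] v[of j] N have "2 * (J (v i) + J (v j) - 2 * m) < e\<^sup>2" by argo
      with par[of "v i" "v j"] have "(norm (v i - v j))\<^sup>2 < e\<^sup>2" by linarith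
      then show ?thesis using \<open>0 < e\<close> by (simp add: dist_norm power_less_imp_less_base)
    qed
    then show "\<exists>M. \<forall>i\<ge>M. \<forall>j\<ge>M. dist (v i) (v j) < e" by blast
  qed
  then obtain g where g: "v \<longlonglongrightarrow> g" using Cauchy_convergent convergent_def by blast
  have "(\<lambda>n. J (v n)) \<longlonglongrightarrow> J g"
    unfolding J_def by (intro tendsto_intros f.tendsto g)
  moreover have "(\<lambda>n. m + inverse (real (Suc n))) \<longlonglongrightarrow> m"
    using tendsto_add[OF tendsto_const LIMSEQ_inverse_real_of_nat] by auto
  ultimately have Jg: "J g \<le> m"
    by (rule LIMSEQ_le) (use v in \<open>auto intro: less_imp_le\<close>)
  have "f h = inner h g" for h
  proof (cases "h = 0")
    case True then show ?thesis by (simp add: f.zero)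
  next
    case False
    define t where "t = (f h - inner h g) / inner h h"
    have "J g \<le> J (g + t *\<^sub>R h)" using Jg m_le order_trans by blast
    also have "J (g + t *\<^sub>R h) = J g - 2 * t * (f h - inner h g) + t * (t * inner h h)"
      unfolding J_def by (simp add: f.add f.scaleR inner_simps inner_commute algebra_simps)
    also have "t * inner h h = f h - inner h g" using False by (simp add: t_def)
    finally have "t * (f h - inner h g) \<le> 0" by simp
    then have "(f h - inner h g)\<^sup>2 \<le> 0"
      using False by (auto simp: t_def power2_eq_square divide_le_0_iff not_le[symmetric]
          dest: inner_gt_zero_iff[THEN iffD2])
    then show ?thesis by simp
  qed
  then show ?thesis by blast
qed

lemma GDERIV_gradient:
  fixes F :: "'a::{real_inner, complete_space} \<Rightarrow> real"
  assumes "F differentiable (at x)"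
  shows "GDERIV F x :> gradient F x"
proof -
  obtain D where D: "(F has_derivative D) (at x)" using assms by (auto simp: differentiable_def)
  obtain g where "\<forall>h. D h = inner h g"
    using riesz_representation has_derivative_bounded_linear[OF D] by blast
  with D have g: "GDERIV F x :> g" unfolding gderiv_def by (metis has_derivative_eq_rhs ext)
  have "g' = g" if "GDERIV F x :> g'" for g'
  proof -
    have "(\<lambda>h. inner h g') = (\<lambda>h. inner h g)"
      using that g unfolding gderiv_def by (rule has_derivative_unique)
    then show ?thesis by (metis inner_commute vector_eq_rdot)
  qed
  with g show ?thesis unfolding gradient_def by (rule theI)
qed

definition locally_lipschitz :: "('a::metric_space \<Rightarrow> 'b::metric_space) \<Rightarrow> bool" where
  "locally_lipschitz f \<longleftrightarrow> (\<forall>x. \<exists>r>0. \<exists>L. L-lipschitz_on (ball x r) f)"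

definition local_minimizer :: "('a::metric_space \<Rightarrow> real) \<Rightarrow> 'a \<Rightarrow> bool" where
  "local_minimizer F x \<longleftrightarrow> (\<exists>r>0. \<forall>y\<in>ball x r. F x \<le> F y)"

(* In both step sizes x is the previous and y the current iterate. *)
definition bb1 :: "('a::real_inner \<Rightarrow> 'a) \<Rightarrow> 'a \<Rightarrow> 'a \<Rightarrow> real" where
  "bb1 G x y = inner (y - x) (G y - G x) / inner (y - x) (y - x)"

definition bb2 :: "('a::real_inner \<Rightarrow> 'a) \<Rightarrow> 'a \<Rightarrow> 'a \<Rightarrow> real" where
  "bb2 G x y = inner (G y - G x) (G y - G x) / inner (y - x) (G y - G x)"

(* Whether bb1 or bb2 is used may vary arbitrarily from iteration to iteration.
   Since division by zero yields zero, a vanishing denominator (or step size) at an iterate with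
   nonzero gradient does not exclude a sequence; the sequence then stays at that iterate forever.
   Hence R-linear convergence of all BB sequences entails that no such breakdown occurs. *)
definition bb_sequence :: "('a::real_inner \<Rightarrow> 'a) \<Rightarrow> (nat \<Rightarrow> 'a) \<Rightarrow> bool" where
  "bb_sequence G u \<longleftrightarrow>
     (\<forall>k\<ge>1. if G (u k) = 0 then u (k + 1) = u k
       else \<exists>\<alpha>\<in>{bb1 G (u (k - 1)) (u k), bb2 G (u (k - 1)) (u k)}.
              u (k + 1) = u k - (1 / \<alpha>) *\<^sub>R G (u k))"

end

theory Submission
  imports Defs "HOL-Computational_Algebra.Polynomial"
begin

text \<open>
  Let $A$ be the operator of the Hessian at the minimizer, with spectrum in $[a, b]$, $a > 0$.
  Close to the minimizer the gradients satisfy $g_{k+1} = (I - A / \alpha_k) g_k + e_k$ with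
  $e_k$ small relative to $g_k$, and up to a small error $\alpha_{k+1}$ is at least the Rayleigh
  quotient of $A$ at $g_k$: the previous displacement is a multiple of the previous gradient.
  So there is one delay, the norms of the gradients are not monotone, and the theorem follows
  once the gradient norm is known to halve within some fixed number of steps
  (\<open>perturbed_bb_halving\<close>).

  Suppose the norm stays above half of its initial value. Split the spectrum into the finitely
  many bands with end points $a (5/4)^p$. If at all later times the part of $g_k$ in the spectrum
  below $c$ is small, then, as $g_k$ itself is not small, its Rayleigh quotient is nearly at
  least $c$, hence $\alpha_{k+1} \geq 5c/6$. On the spectrum below $5c/4$ the factor $1 - t / \alpha$
  then lies between $-1/2$ and a constant below $1$, so the part of the gradient below $5c/4$
  decays geometrically and soon is small as well. Nothing lies below $a$, so this starts with
  $c = a$; after finitely many bands it says that the whole gradient is small, a contradiction.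

  An approximate splitting of the norm along the spectrum is enough for this, and Bernstein
  polynomials provide one. Those of degree $n$ on $[a, b]$ form a partition of unity, and
  applied to $A$ they are positive operators $B_j$. The numbers $(B_j g, g)$ are nonnegative, their
  sum is $\|g\|^2$, and their sum weighted with the nodes $t_j$ is exactly $(A g, g)$: a
  discrete substitute for the spectral measure of $g$. A step does not multiply these masses by
  $(1 - t_j / \alpha)^2$ exactly, but the error is governed by the variance of the Bernstein
  weights, which is of order $1 / n$ (\<open>sum_mass_variance\<close>). As only a fixed number of steps is
  considered, this error and the nonlinear remainder $e_k$ can be treated alike, by taking first
  $n$ large and then the neighbourhood small.
\<close>

section \<open>Bernstein masses of a self-adjoint operator\<close>

definition op_poly :: "('a::real_vector \<Rightarrow> 'a) \<Rightarrow> real poly \<Rightarrow> 'a \<Rightarrow> 'a" where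
  "op_poly A p = fold_coeffs (\<lambda>c f v. c *\<^sub>R v + A (f v)) p (\<lambda>v. 0)"

text \<open>
  The bounds on the form confine the spectrum to \<open>{a..b}\<close>, and they make the operator bounded
  (\<open>norm_A_le\<close>). The interval is nondegenerate since Bernstein polynomials are to be used on it.
\<close>

locale spectrum_between =
  fixes A :: "'a::real_inner \<Rightarrow> 'a" and a b :: real
  assumes linear: "linear A"
    and self_adjoint: "inner (A v) w = inner v (A w)"
    and form_ge: "a * (norm v)\<^sup>2 \<le> inner (A v) v"
    and form_le: "inner (A v) v \<le> b * (norm v)\<^sup>2"
    and a_pos: "0 < a" and a_less_b: "a < b"
begin

abbreviation "poly_A \<equiv> op_poly A"

lemma op_poly_0 [simp]: "poly_A 0 v = 0"
  by (simp add: op_poly_def)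

lemma op_poly_pCons [simp]: "poly_A (pCons c p) v = c *\<^sub>R v + A (poly_A p v)"
  using linear_0[OF linear] by (cases "p = 0 \<and> c = 0") (auto simp: op_poly_def)

lemma linear_op_poly: "linear (poly_A p)"
  by (induction p)
    (auto simp: linear_iff algebra_simps linear_add[OF linear] linear_scale[OF linear])

lemma op_poly_add: "poly_A (p + q) v = poly_A p v + poly_A q v"
  by (induction p q rule: poly_induct2) (simp_all add: linear_add[OF linear] algebra_simps)

lemma op_poly_smult [simp]: "poly_A (smult c p) v = c *\<^sub>R poly_A p v"
  by (induction p) (simp_all add: linear_scale[OF linear] linear_0[OF linear] algebra_simps)

lemma op_poly_diff: "poly_A (p - q) v = poly_A p v - poly_A q v"
proof -
  have "poly_A (- q) v = - poly_A q v"
    using op_poly_smult[of "-1" q v] by (simp del: op_poly_smult)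
  then show ?thesis using op_poly_add[of p "- q" v] by simp
qed

lemma op_poly_sum: "poly_A (sum P I) v = (\<Sum>i\<in>I. poly_A (P i) v)"
  by (induction I rule: infinite_finite_induct) (simp_all add: op_poly_add)

lemma op_poly_mult: "poly_A (p * q) v = poly_A p (poly_A q v)"
  by (induction p) (simp_all add: op_poly_add)

lemma op_poly_self_adjoint: "inner (poly_A p v) w = inner v (poly_A p w)"
proof (induction p arbitrary: v w)
  case (pCons c p)
  have comm: "A (poly_A p w) = poly_A p (A w)"
    using op_poly_mult[of "[:0, 1:]" p w] op_poly_mult[of p "[:0, 1:]" w]
    by (simp add: mult.commute linear_0[OF linear])
  show ?case
    by (simp add: inner_add_left inner_add_right self_adjoint pCons comm)
qed simp

definition form :: "real poly \<Rightarrow> 'a \<Rightarrow> real" where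
  "form p v = inner (poly_A p v) v"

text \<open>
  This is the source of all positivity below: multiplying a polynomial by a square amounts to
  evaluating its form at another vector.
\<close>

lemma form_mult_square: "form (p * q\<^sup>2) v = form p (poly_A q v)"
  by (simp add: form_def power2_eq_square op_poly_mult op_poly_self_adjoint[of q]
      mult.left_commute[of _ q])

lemma form_one: "form 1 v = (norm v)\<^sup>2"
  by (simp add: form_def one_pCons power2_norm_eq_inner linear_0[OF linear])

lemma form_X: "form [:0, 1:] v = inner (A v) v"
  by (simp add: form_def linear_0[OF linear])

lemma form_add: "form (p + q) v = form p v + form q v"
  and form_diff: "form (p - q) v = form p v - form q v"
  and form_smult: "form (smult c p) v = c * form p v"
  and form_sum: "form (sum P I) v = (\<Sum>i\<in>I. form (P i) v)"
  by (simp_all add: form_def op_poly_add op_poly_diff op_poly_sum inner_add_left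
      inner_diff_left inner_sum_left)

definition nonneg_form :: "real poly \<Rightarrow> bool" where
  "nonneg_form p \<longleftrightarrow> (\<forall>v. 0 \<le> form p v)"

lemma nonneg_form_mult_square: "nonneg_form p \<Longrightarrow> nonneg_form (p * q\<^sup>2)"
  by (simp add: nonneg_form_def form_mult_square)

text \<open>The affine map from \<open>{a..b}\<close> onto \<open>{0..1}\<close>, the coordinate of the Bernstein polynomials.\<close>

definition unit_poly :: "real poly" where
  "unit_poly = smult (1 / (b - a)) [:- a, 1:]"

lemma poly_unit_poly: "poly unit_poly t = (t - a) / (b - a)"
  by (simp add: unit_poly_def diff_divide_distrib)

lemma form_unit_poly: "form unit_poly v = (inner (A v) v - a * (norm v)\<^sup>2) / (b - a)"
  by (simp add: unit_poly_def form_smult del: smult_pCons)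
    (simp add: form_def linear_0[OF linear] inner_add_left inner_diff_left power2_norm_eq_inner)

lemma nonneg_form_unit: "nonneg_form unit_poly"
  using form_ge a_less_b by (auto simp: nonneg_form_def form_unit_poly)

lemma nonneg_form_one_minus_unit: "nonneg_form (1 - unit_poly)"
  unfolding nonneg_form_def
proof
  fix v
  have "form unit_poly v \<le> (norm v)\<^sup>2"
    using form_le[of v] a_less_b by (simp add: form_unit_poly divide_le_eq algebra_simps)
  then show "0 \<le> form (1 - unit_poly) v"
    by (simp add: form_diff form_one)
qed

text \<open>
  As the two factors sum to one, their product is a sum of products of one factor with the square
  of the other.
\<close>

lemma nonneg_form_unit_one_minus_unit: "nonneg_form (unit_poly * (1 - unit_poly))"
proof -
  have "unit_poly * (1 - unit_poly)
      = (1 - unit_poly) * unit_poly\<^sup>2 + unit_poly * (1 - unit_poly)\<^sup>2"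
    by (simp add: algebra_simps power2_eq_square)
  then show ?thesis
    using nonneg_form_mult_square[OF nonneg_form_unit] nonneg_form_mult_square[OF nonneg_form_one_minus_unit]
    by (simp add: nonneg_form_def form_add)
qed

text \<open>Up to squares, both exponents are 0 or 1.\<close>

lemma nonneg_form_unit_powers: "nonneg_form (unit_poly ^ i * (1 - unit_poly) ^ k)"
proof -
  have split: "x ^ i = x ^ (i mod 2) * (x ^ (i div 2))\<^sup>2" for x :: "real poly" and i
  proof -
    have "x ^ i = x ^ (i mod 2 + i div 2 * 2)" by simp
    then show ?thesis by (simp only: power_add power_mult)
  qed
  have "nonneg_form (unit_poly ^ (i mod 2) * (1 - unit_poly) ^ (k mod 2))"
  proof -
    have "nonneg_form 1" by (simp add: nonneg_form_def form_one)
    moreover have "i mod 2 = 0 \<or> i mod 2 = 1" "k mod 2 = 0 \<or> k mod 2 = 1" by auto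
    ultimately show ?thesis
      using nonneg_form_unit nonneg_form_one_minus_unit nonneg_form_unit_one_minus_unit
      by (elim disjE) simp_all
  qed
  from nonneg_form_mult_square[OF this, of "unit_poly ^ (i div 2) * (1 - unit_poly) ^ (k div 2)"]
  have "nonneg_form ((unit_poly ^ (i mod 2) * (unit_poly ^ (i div 2))\<^sup>2)
      * ((1 - unit_poly) ^ (k mod 2) * ((1 - unit_poly) ^ (k div 2))\<^sup>2))"
    by (simp add: power_mult_distrib ac_simps)
  then show ?thesis
    by (simp only: split[symmetric])
qed

text \<open>
  Positivity of \<open>(A - a) (b - A)\<close> bounds the square of \<open>A\<close> by \<open>A\<close> itself, whose form is
  bounded by assumption.
\<close>

lemma norm_A_le: "norm (A v) \<le> b * norm v"
proof -
  have "0 \<le> form (smult ((b - a)\<^sup>2) (unit_poly * (1 - unit_poly))) v"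
    using nonneg_form_unit_one_minus_unit by (simp add: nonneg_form_def form_smult)
  also have "smult ((b - a)\<^sup>2) (unit_poly * (1 - unit_poly)) = [:- a * b, a + b, -1:]"
  proof (intro poly_eq_poly_eq_iff[THEN iffD1] ext)
    fix t
    define x where "x = (t - a) / (b - a)"
    have t: "t = a + (b - a) * x" using a_less_b by (simp add: x_def)
    have "poly (smult ((b - a)\<^sup>2) (unit_poly * (1 - unit_poly))) t = (b - a)\<^sup>2 * (x * (1 - x))"
      by (simp add: poly_unit_poly x_def)
    then show "poly (smult ((b - a)\<^sup>2) (unit_poly * (1 - unit_poly))) t = poly [:- a * b, a + b, -1:] t"
      by (simp add: t algebra_simps power2_eq_square)
  qed
  also have "form \<dots> v = (a + b) * inner (A v) v - a * b * (norm v)\<^sup>2 - (norm (A v))\<^sup>2"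
    by (simp add: form_def linear_0[OF linear] linear_add[OF linear] linear_scale[OF linear]
        linear_neg[OF linear] inner_add_left power2_norm_eq_inner self_adjoint algebra_simps)
  finally have "(norm (A v))\<^sup>2 \<le> (a + b) * inner (A v) v - a * b * (norm v)\<^sup>2" by simp
  also have "\<dots> \<le> (a + b) * (b * (norm v)\<^sup>2) - a * b * (norm v)\<^sup>2"
    using form_le[of v] a_pos a_less_b by (intro diff_right_mono mult_left_mono) auto
  also have "\<dots> = (b * norm v)\<^sup>2" by (simp add: algebra_simps power2_eq_square)
  finally show ?thesis
    by (rule power2_le_imp_le) (use a_pos a_less_b in simp)
qed

definition bern :: "nat \<Rightarrow> nat \<Rightarrow> real poly" where
  "bern n j = smult (of_nat (n choose j)) (unit_poly ^ j * (1 - unit_poly) ^ (n - j))"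

definition node :: "nat \<Rightarrow> nat \<Rightarrow> real" where
  "node n j = a + (b - a) * j / n"

lemma poly_bern: "poly (bern n j) t = Bernstein n j ((t - a) / (b - a))"
  by (simp add: bern_def Bernstein_def poly_unit_poly)

text \<open>
  The vector \<open>mass n _ v\<close> replaces the spectral measure of \<open>v\<close>: up to an uncertainty of order
  \<open>1 / sqrt n\<close> in the position, \<open>mass n j v\<close> is the part of the squared norm of \<open>v\<close> that belongs
  to spectral values near \<open>node n j\<close>.
\<close>

definition mass :: "nat \<Rightarrow> nat \<Rightarrow> 'a \<Rightarrow> real" where
  "mass n j v = form (bern n j) v"

lemma mass_nonneg: "0 \<le> mass n j v"
  using nonneg_form_unit_powers by (simp add: mass_def bern_def form_smult nonneg_form_def)

lemma sum_mass: "(\<Sum>j\<le>n. mass n j v) = (norm v)\<^sup>2"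
proof -
  have "(\<Sum>j\<le>n. bern n j) = 1"
    by (intro poly_eq_poly_eq_iff[THEN iffD1] ext) (simp add: poly_sum poly_bern)
  then show ?thesis
    by (simp add: mass_def form_one flip: form_sum)
qed

lemma sum_node_mass:
  assumes "n > 0"
  shows "(\<Sum>j\<le>n. node n j * mass n j v) = inner (A v) v"
proof -
  have "(\<Sum>j\<le>n. smult (node n j) (bern n j)) = [:0, 1:]"
  proof (intro poly_eq_poly_eq_iff[THEN iffD1] ext)
    fix t
    have "poly (\<Sum>j\<le>n. smult (node n j) (bern n j)) t
      = a * (\<Sum>j\<le>n. Bernstein n j ((t - a) / (b - a)))
        + (b - a) / n * (\<Sum>j\<le>n. j * Bernstein n j ((t - a) / (b - a)))"
      by (simp add: poly_sum poly_bern node_def sum_distrib_left sum.distrib[symmetric]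
          algebra_simps del: sum_k_Bernstein sum_Bernstein)
    also have "\<dots> = t" using assms a_less_b by simp
    finally show "poly (\<Sum>j\<le>n. smult (node n j) (bern n j)) t = poly [:0, 1:] t" by simp
  qed
  then show ?thesis
    by (simp add: mass_def flip: form_X form_smult form_sum)
qed

text \<open>
  The variance of the binomial distribution, read as an identity between polynomials in \<open>A\<close>:
  on the \<open>j\<close>-th mass the operator acts almost like the scalar \<open>node n j\<close>.
\<close>

lemma sum_mass_variance:
  assumes "n > 0"
  shows "(\<Sum>j\<le>n. mass n j (A v - node n j *\<^sub>R v)) \<le> b\<^sup>2 / n * (norm v)\<^sup>2"
proof -
  have eq: "mass n j (A v - node n j *\<^sub>R v) = form (bern n j * [:- node n j, 1:]\<^sup>2) v" for j
    by (simp add: mass_def form_mult_square linear_0[OF linear])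
  have "(\<Sum>j\<le>n. bern n j * [:- node n j, 1:]\<^sup>2)
      = smult ((b - a)\<^sup>2 / n) (unit_poly * (1 - unit_poly))"
  proof (intro poly_eq_poly_eq_iff[THEN iffD1] ext)
    fix t
    define x where "x = (t - a) / (b - a)"
    have t: "t = a + (b - a) * x" using a_less_b by (simp add: x_def)
    have sq: "(t - node n j)\<^sup>2 = (b - a)\<^sup>2 / n\<^sup>2 * (n\<^sup>2 * x\<^sup>2 - 2 * n * x * j + j * (real j - 1) + j)" for j
      using assms by (simp add: t node_def field_simps power2_eq_square)
    have "poly (\<Sum>j\<le>n. bern n j * [:- node n j, 1:]\<^sup>2) t = (\<Sum>j\<le>n. Bernstein n j x * (t - node n j)\<^sup>2)"
      by (simp add: poly_sum poly_bern x_def)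
    also have "\<dots> = (b - a)\<^sup>2 / n\<^sup>2 * (n\<^sup>2 * x\<^sup>2 * (\<Sum>j\<le>n. Bernstein n j x)
        - 2 * n * x * (\<Sum>j\<le>n. j * Bernstein n j x)
        + (\<Sum>j\<le>n. j * (real j - 1) * Bernstein n j x) + (\<Sum>j\<le>n. j * Bernstein n j x))"
      unfolding sq sum_distrib_left sum_subtractf[symmetric] sum.distrib[symmetric]
      by (intro sum.cong refl) (simp add: algebra_simps)
    also have "\<dots> = (b - a)\<^sup>2 / n\<^sup>2 * (n * (x * (1 - x)))"
      unfolding sum_Bernstein sum_k_Bernstein sum_kk_Bernstein
      by (simp add: algebra_simps power2_eq_square)
    also have "\<dots> = (b - a)\<^sup>2 / n * (x * (1 - x))"
      using assms by (simp add: power2_eq_square)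
    finally show "poly (\<Sum>j\<le>n. bern n j * [:- node n j, 1:]\<^sup>2) t
        = poly (smult ((b - a)\<^sup>2 / n) (unit_poly * (1 - unit_poly))) t"
      by (simp add: poly_unit_poly x_def)
  qed
  then have "(\<Sum>j\<le>n. mass n j (A v - node n j *\<^sub>R v))
      = (b - a)\<^sup>2 / n * form (unit_poly * (1 - unit_poly)) v"
    by (simp add: eq form_smult flip: form_sum)
  also have "\<dots> \<le> b\<^sup>2 / n * (norm v)\<^sup>2"
  proof (intro mult_mono divide_right_mono power_mono)
    have "unit_poly * (1 - unit_poly) = unit_poly - 1 * unit_poly\<^sup>2"
      by (simp add: algebra_simps power2_eq_square)
    moreover have "0 \<le> form (1 * unit_poly\<^sup>2) v" unfolding form_mult_square by (simp add: form_one)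
    moreover have "form unit_poly v \<le> form 1 v"
      using nonneg_form_one_minus_unit by (simp add: nonneg_form_def form_diff)
    ultimately show "form (unit_poly * (1 - unit_poly)) v \<le> (norm v)\<^sup>2"
      by (simp add: form_diff form_one)
  qed (use a_pos a_less_b nonneg_form_unit_one_minus_unit in \<open>auto simp: nonneg_form_def\<close>)
  finally show ?thesis .
qed

text \<open>
  The square of a sum with Young's inequality: a small \<open>\<epsilon>\<close> keeps the loss in the leading
  term below the gain of a contraction.
\<close>

lemma mass_add_le:
  assumes "\<epsilon> > 0"
  shows "mass n j (v + w) \<le> (1 + \<epsilon>) * mass n j v + (1 + 1 / \<epsilon>) * mass n j w"
proof -
  define B where "B = poly_A (bern n j)"
  have add: "B (x + y) = B x + B y" and scale: "B (c *\<^sub>R x) = c *\<^sub>R B x" for x y c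
    unfolding B_def by (simp_all add: linear_add linear_scale linear_op_poly)
  have sa: "inner (B x) y = inner x (B y)" for x y
    by (simp add: B_def op_poly_self_adjoint)
  have m: "mass n j x = inner (B x) x" for x by (simp add: mass_def form_def B_def)
  have "0 \<le> mass n j (\<epsilon> *\<^sub>R v - w)" by (rule mass_nonneg)
  also have "\<epsilon> *\<^sub>R v - w = \<epsilon> *\<^sub>R v + (-1) *\<^sub>R w" by simp
  also have "mass n j \<dots> = \<epsilon> * (\<epsilon> * inner (B v) v) - 2 * (\<epsilon> * inner (B v) w) + inner (B w) w"
    unfolding m add scale inner_add_left inner_add_right inner_scaleR_left inner_scaleR_right
      sa[of w v] inner_commute[of w "B v"]
    by (simp add: algebra_simps)
  finally have "2 * inner (B v) w \<le> \<epsilon> * inner (B v) v + 1 / \<epsilon> * inner (B w) w"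
    using assms by (simp add: field_simps)
  then show ?thesis
    unfolding m add inner_add_left inner_add_right sa[of w v] inner_commute[of w "B v"]
    by (simp add: distrib_right)
qed

lemma mass_scaleR: "mass n j (c *\<^sub>R v) = c\<^sup>2 * mass n j v"
  by (simp add: mass_def form_def linear_scale[OF linear_op_poly] power2_eq_square)

end

section \<open>Decay of the spectral masses along the iteration\<close>

lemma perturbed_contraction:
  fixes f :: "nat \<Rightarrow> real"
  assumes step: "\<And>i. s \<le> i \<Longrightarrow> i < s + k \<Longrightarrow> f (Suc i) \<le> \<rho> * f i + h"
    and \<rho>: "0 \<le> \<rho>" "\<rho> < 1" and h: "0 \<le> h"
  shows "f (s + k) \<le> \<rho> ^ k * f s + h / (1 - \<rho>)"
  using step
proof (induction k)
  case 0
  then show ?case using \<rho> h by simp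
next
  case (Suc k)
  have "f (s + Suc k) \<le> \<rho> * f (s + k) + h" using Suc.prems[of "s + k"] by simp
  also have "\<dots> \<le> \<rho> * (\<rho> ^ k * f s + h / (1 - \<rho>)) + h"
    using Suc \<rho> by (intro add_right_mono mult_left_mono Suc.IH) auto
  also have "\<dots> = \<rho> ^ Suc k * f s + h / (1 - \<rho>)"
    using \<rho> by (simp add: field_simps)
  finally show ?case .
qed

context spectrum_between
begin

definition low_mass :: "nat \<Rightarrow> real \<Rightarrow> 'a \<Rightarrow> real" where
  "low_mass n c v = (\<Sum>j | j \<le> n \<and> node n j < c. mass n j v)"

lemma node_ge: "a \<le> node n j"
  using a_less_b by (simp add: node_def)

lemma node_le: "n > 0 \<Longrightarrow> j \<le> n \<Longrightarrow> node n j \<le> b"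
  using mult_left_mono[of "real j / real n" 1 "b - a"] a_less_b by (simp add: node_def)

lemma low_mass_le: "low_mass n c v \<le> (norm v)\<^sup>2"
  unfolding low_mass_def sum_mass[of n, symmetric]
  by (intro sum_mono2) (auto simp: mass_nonneg)

lemma low_mass_below: "low_mass n a v = 0"
  unfolding low_mass_def by (rule sum.neutral) (use node_ge in \<open>auto simp: not_less[symmetric]\<close>)

lemma low_mass_above:
  assumes "n > 0" "b < c"
  shows "low_mass n c v = (norm v)\<^sup>2"
proof -
  have "{j. j \<le> n \<and> node n j < c} = {..n}"
    using node_le[OF assms(1)] assms(2) by force
  then show ?thesis by (simp add: low_mass_def sum_mass)
qed

text \<open>All mass that is not low sits at nodes of at least \<open>c\<close>, and no node is negative.\<close>

lemma rayleigh_ge_of_low_mass: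
  assumes "n > 0" "0 < c"
  shows "c * ((norm v)\<^sup>2 - low_mass n c v) \<le> inner (A v) v"
proof -
  let ?L = "{j. j \<le> n \<and> node n j < c}"
  have "(norm v)\<^sup>2 = low_mass n c v + (\<Sum>j\<in>{..n} - ?L. mass n j v)"
    unfolding low_mass_def sum_mass[of n, symmetric] by (subst sum.subset_diff[of ?L]) auto
  then have "c * ((norm v)\<^sup>2 - low_mass n c v) = (\<Sum>j\<in>{..n} - ?L. c * mass n j v)"
    by (simp add: sum_distrib_left)
  also have "\<dots> \<le> (\<Sum>j\<in>{..n} - ?L. node n j * mass n j v)"
    by (intro sum_mono mult_right_mono mass_nonneg) auto
  also have "\<dots> \<le> (\<Sum>j\<le>n. node n j * mass n j v)"
    using a_pos by (intro sum_mono2 mult_nonneg_nonneg mass_nonneg order_trans[OF _ node_ge]) auto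
  finally show ?thesis using sum_node_mass[OF assms(1)] by simp
qed

text \<open>
  On the \<open>j\<close>-th mass, \<open>A\<close> is replaced by the scalar \<open>node n j\<close>; the replacement error enters
  only through the variance. The factor obtained from the squared contraction is \<open>\<rho>\<close> and not
  \<open>\<rho>\<^sup>2\<close>: the difference pays for separating the error terms.
\<close>

lemma low_mass_step:
  assumes n: "n > 0" and "0 < \<alpha>" and \<rho>: "0 < \<rho>" "\<rho> < 1"
    and contr: "\<And>j. j \<le> n \<Longrightarrow> node n j < c \<Longrightarrow> \<bar>1 - node n j / \<alpha>\<bar> \<le> \<rho>"
  shows "low_mass n c (v - (1 / \<alpha>) *\<^sub>R A v + e)
    \<le> \<rho> * low_mass n c v + 2 / (1 - \<rho>) * (b\<^sup>2 / (n * \<alpha>\<^sup>2) * (norm v)\<^sup>2 + (norm e)\<^sup>2)"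
proof -
  let ?L = "{j. j \<le> n \<and> node n j < c}"
  define d where "d j = A v - node n j *\<^sub>R v" for j
  have term_le: "mass n j (v - (1 / \<alpha>) *\<^sub>R A v + e)
      \<le> \<rho> * mass n j v + 2 / (1 - \<rho>) * (mass n j (d j) / \<alpha>\<^sup>2 + mass n j e)" if "j \<in> ?L" for j
  proof -
    define t where "t = node n j"
    have split: "v - (1 / \<alpha>) *\<^sub>R A v + e = (1 - t / \<alpha>) *\<^sub>R v + ((- 1 / \<alpha>) *\<^sub>R d j + e)"
      by (simp add: d_def t_def algebra_simps)
    \<comment> \<open>The choice \<open>\<epsilon> = 1 / \<rho> - 1\<close> turns \<open>(1 + \<epsilon>) * \<rho>\<^sup>2\<close> into \<open>\<rho>\<close>.\<close>
    have eps: "1 / \<rho> - 1 > 0" "1 + (1 / \<rho> - 1) = 1 / \<rho>" "1 + 1 / (1 / \<rho> - 1) = 1 / (1 - \<rho>)"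
      using \<rho> by (simp_all add: field_simps)
    have "mass n j ((- 1 / \<alpha>) *\<^sub>R d j + e) \<le> 2 * (mass n j (d j) / \<alpha>\<^sup>2 + mass n j e)"
      using mass_add_le[of 1 n j "(- 1 / \<alpha>) *\<^sub>R d j" e] unfolding mass_scaleR
      by (simp add: power_divide)
    moreover have "1 / \<rho> * ((1 - t / \<alpha>)\<^sup>2 * mass n j v) \<le> \<rho> * mass n j v"
    proof -
      have "(1 - t / \<alpha>)\<^sup>2 \<le> \<rho>\<^sup>2"
        using contr[of j] that \<rho>(1) by (auto simp: t_def abs_le_square_iff[symmetric])
      then have "(1 - t / \<alpha>)\<^sup>2 * mass n j v \<le> \<rho>\<^sup>2 * mass n j v"
        by (intro mult_right_mono mass_nonneg)
      then show ?thesis using \<rho>(1) by (simp add: field_simps power2_eq_square)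
    qed
    moreover have "mass n j (v - (1 / \<alpha>) *\<^sub>R A v + e)
        \<le> 1 / \<rho> * ((1 - t / \<alpha>)\<^sup>2 * mass n j v) + 1 / (1 - \<rho>) * mass n j ((- 1 / \<alpha>) *\<^sub>R d j + e)"
      unfolding split
      using mass_add_le[OF eps(1), of n j "(1 - t / \<alpha>) *\<^sub>R v" "(- 1 / \<alpha>) *\<^sub>R d j + e"]
      unfolding eps(2,3) mass_scaleR .
    moreover have "1 / (1 - \<rho>) * mass n j ((- 1 / \<alpha>) *\<^sub>R d j + e)
        \<le> 1 / (1 - \<rho>) * (2 * (mass n j (d j) / \<alpha>\<^sup>2 + mass n j e))"
      using calculation(1) \<rho> by (intro mult_left_mono) auto
    ultimately show ?thesis by simp
  qed
  have sub: "(\<Sum>j\<in>?L. mass n j (w j)) \<le> (\<Sum>j\<le>n. mass n j (w j))" for w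
    by (intro sum_mono2) (auto simp: mass_nonneg)
  have "low_mass n c (v - (1 / \<alpha>) *\<^sub>R A v + e)
      \<le> (\<Sum>j\<in>?L. \<rho> * mass n j v + 2 / (1 - \<rho>) * (mass n j (d j) / \<alpha>\<^sup>2 + mass n j e))"
    unfolding low_mass_def by (intro sum_mono term_le)
  also have "\<dots> = \<rho> * low_mass n c v
      + 2 / (1 - \<rho>) * ((\<Sum>j\<in>?L. mass n j (d j)) / \<alpha>\<^sup>2 + (\<Sum>j\<in>?L. mass n j e))"
    unfolding low_mass_def
    by (simp add: sum.distrib sum_distrib_left[symmetric] sum_divide_distrib[symmetric])
  also have "(\<Sum>j\<in>?L. mass n j (d j)) / \<alpha>\<^sup>2 \<le> b\<^sup>2 / n * (norm v)\<^sup>2 / \<alpha>\<^sup>2"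
    using order_trans[OF sub sum_mass_variance[OF n]] unfolding d_def
    by (intro divide_right_mono) auto
  also have "(\<Sum>j\<in>?L. mass n j e) \<le> (norm e)\<^sup>2"
    using sub[of "\<lambda>_. e"] by (simp add: sum_mass)
  finally show ?thesis using \<rho> by (simp add: divide_right_mono mult_left_mono)
qed

lemma norm_step_le:
  assumes "a / 2 \<le> \<alpha>" "norm e \<le> \<eta> * norm v" "\<eta> \<le> 1"
  shows "norm (v - (1 / \<alpha>) *\<^sub>R A v + e) \<le> (2 + 2 * b / a) * norm v"
proof -
  have \<alpha>: "\<alpha> > 0" "1 / \<alpha> \<le> 2 / a" using assms(1) a_pos by (auto simp: field_simps)
  have "norm (v - (1 / \<alpha>) *\<^sub>R A v + e) \<le> norm v + norm ((1 / \<alpha>) *\<^sub>R A v) + norm e"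
    by (meson norm_triangle_ineq norm_triangle_ineq4 add_mono order_refl order_trans)
  also have "norm ((1 / \<alpha>) *\<^sub>R A v) \<le> 2 / a * (b * norm v)"
    using \<alpha> norm_A_le[of v] a_pos unfolding norm_scaleR
    by (intro mult_mono) auto
  also have "norm e \<le> 1 * norm v"
    using assms(2,3) mult_right_mono[of \<eta> 1 "norm v"] by simp
  finally show ?thesis by (simp add: algebra_simps)
qed

text \<open>
  Here the delay of the method enters. The step size belongs to the preceding gradient \<open>w\<close>; if \<open>w\<close>
  has little mass below \<open>c\<close>, its Rayleigh quotient is at least \<open>7 / 8 * c\<close>, so the step size is at
  least \<open>5 / 6 * c\<close> and the step from \<open>v\<close> multiplies the masses below \<open>5 / 4 * c\<close> by factors
  \<open>1 - t / \<alpha>\<close> of at least \<open>1 - 3 / 2\<close>.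
\<close>

lemma low_mass_next_band:
  assumes n: "n > 0" and \<rho>: "\<rho> = 1 - a / B" and B: "2 * a \<le> B" and c: "a \<le> c"
    and \<eta>: "\<eta> \<le> a / 24" and \<alpha>: "\<alpha> \<le> B" "inner (A w) w \<le> (\<alpha> + \<eta>) * (norm w)\<^sup>2"
    and w: "w \<noteq> 0" "low_mass n c w \<le> (norm w)\<^sup>2 / 8"
  shows "low_mass n (5 / 4 * c) (v - (1 / \<alpha>) *\<^sub>R A v + e)
    \<le> \<rho> * low_mass n (5 / 4 * c) v + 2 / (1 - \<rho>) * (b\<^sup>2 / (n * \<alpha>\<^sup>2) * (norm v)\<^sup>2 + (norm e)\<^sup>2)"
proof -
  have c0: "0 < c" and B0: "0 < B" using a_pos c B by auto
  have \<rho>': "1 / 2 \<le> \<rho>" "\<rho> < 1" using B a_pos B0 by (auto simp: \<rho> field_simps)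
  have "7 / 8 * c * (norm w)\<^sup>2 = c * ((norm w)\<^sup>2 - (norm w)\<^sup>2 / 8)" by simp
  also have "\<dots> \<le> c * ((norm w)\<^sup>2 - low_mass n c w)"
    using w c0 by (intro mult_left_mono) auto
  also have "\<dots> \<le> (\<alpha> + \<eta>) * (norm w)\<^sup>2"
    using rayleigh_ge_of_low_mass[OF n c0, of w] \<alpha>(2) by linarith
  finally have "7 / 8 * c \<le> \<alpha> + \<eta>" using w(1) by simp
  then have \<alpha>_ge: "5 / 6 * c \<le> \<alpha>" using \<eta> c by linarith
  have \<alpha>0: "0 < \<alpha>" using \<alpha>_ge c0 by linarith
  show ?thesis
  proof (rule low_mass_step[OF n \<alpha>0])
    fix j assume "j \<le> n" and j: "node n j < 5 / 4 * c"
    have "node n j / \<alpha> \<le> 3 / 2" using j \<alpha>_ge \<alpha>0 by (simp add: divide_le_eq)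
    moreover have "a / B \<le> node n j / \<alpha>"
      using node_ge[of n j] \<alpha> \<alpha>0 a_pos by (intro frac_le) auto
    ultimately show "\<bar>1 - node n j / \<alpha>\<bar> \<le> \<rho>" using \<rho>' \<rho> by linarith
  qed (use \<rho>' in auto)
qed

text \<open>
  The sequence \<open>g\<close> stands for a window of gradients of the method. The first step size of the
  window is only confined to an interval, since it depends on an earlier gradient; each later one
  is, up to \<open>\<eta>\<close>, at least the Rayleigh quotient of the preceding gradient. This covers both BB
  step sizes at once.
\<close>

definition halves_within :: "nat \<Rightarrow> real \<Rightarrow> real \<Rightarrow> bool" where
  "halves_within m \<eta> B \<longleftrightarrow> (\<forall>g \<alpha> e.
     (\<forall>i<m. a / 2 \<le> \<alpha> i \<and> \<alpha> i \<le> B) \<and>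
     (\<forall>i<m. g (Suc i) = g i - (1 / \<alpha> i) *\<^sub>R A (g i) + e i) \<and>
     (\<forall>i<m. norm (e i) \<le> \<eta> * norm (g i)) \<and>
     (\<forall>i. Suc i < m \<longrightarrow> inner (A (g i)) (g i) \<le> (\<alpha> (Suc i) + \<eta>) * (norm (g i))\<^sup>2) \<longrightarrow>
     (\<exists>j\<in>{1..m}. norm (g j) \<le> norm (g 0) / 2))"

text \<open>
  The induction over the bands described at the beginning. The masses below \<open>a * (5 / 4) ^ p\<close> are
  small from time \<open>T p\<close> on. Before they contract, the masses of the next band may have grown by the
  factor \<open>D ^ Suc (T p)\<close>; the time \<open>T (Suc p)\<close> leaves the contraction long enough to outweigh this.
  The number of steps \<open>m\<close> is therefore fixed before the accuracies \<open>n\<close> and \<open>\<eta>\<close>, which have to beat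
  the growth over the whole window.
\<close>

theorem perturbed_bb_halving:
  assumes B: "2 * a \<le> B"
  obtains m \<eta> where "m \<ge> 1" "\<eta> > 0" "halves_within m \<eta> B"
proof -
  define \<rho> where "\<rho> = 1 - a / B"
  have \<rho>: "1 / 2 \<le> \<rho>" "\<rho> < 1" using B a_pos by (auto simp: \<rho>_def field_simps)
  define D where "D = (2 + 2 * b / a)\<^sup>2"
  have D: "1 \<le> D" using a_pos a_less_b by (simp add: D_def one_le_power)
  have "\<exists>s>t. \<rho> ^ (s - Suc t) * D ^ Suc t \<le> 1 / 64" for t
  proof -
    have "0 < 1 / (64 * D ^ Suc t)" using D by simp
    then obtain k where "\<rho> ^ k < 1 / (64 * D ^ Suc t)"
      using real_arch_pow_inv[of _ \<rho>] \<rho> by blast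
    then have "\<rho> ^ k * (64 * D ^ Suc t) < 1" using D by (subst (asm) pos_less_divide_eq) auto
    then show ?thesis by (intro exI[of _ "Suc t + k"]) simp
  qed
  then obtain s where s: "\<And>t. t < s t" "\<And>t. \<rho> ^ (s t - Suc t) * D ^ Suc t \<le> 1 / 64"
    by metis
  define T where "T p = (s ^^ p) 0" for p
  have T_Suc: "T (Suc p) = s (T p)" for p by (simp add: T_def)
  obtain P where P: "b / a < (5 / 4) ^ P" using real_arch_pow[of "5 / 4" "b / a"] by auto
  have "P \<noteq> 0" using P a_pos a_less_b by (intro notI) (simp add: field_simps)
  define m where "m = T P"
  have m1: "m \<ge> 1"
    using \<open>P \<noteq> 0\<close> s(1)[of "T (P - 1)"] T_Suc[of "P - 1"] by (simp add: m_def)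
  \<comment> \<open>With this relative error in each step, the accumulated error of a mass is at most \<open>N / 64\<close>.\<close>
  define \<kappa> where "\<kappa> = (1 - \<rho>)\<^sup>2 / (256 * D ^ m)"
  have \<kappa>: "0 < \<kappa>" using \<rho> D by (simp add: \<kappa>_def)
  define \<eta> where "\<eta> = Min {1, a / 24, sqrt \<kappa>}"
  have \<eta>: "0 < \<eta>" "\<eta> \<le> 1" "\<eta> \<le> a / 24" "\<eta> \<le> sqrt \<kappa>"
    using \<kappa> a_pos by (auto simp: \<eta>_def)
  have \<eta>2: "\<eta>\<^sup>2 \<le> \<kappa>" using \<eta>(1,4) \<kappa> power_mono[of \<eta> "sqrt \<kappa>" 2] by simp
  define n where "n = Suc (nat \<lceil>4 * b\<^sup>2 / a\<^sup>2 / \<kappa>\<rceil>)"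
  have n: "n > 0" by (simp add: n_def)
  have "4 * b\<^sup>2 / a\<^sup>2 / \<kappa> \<le> n" unfolding n_def by linarith
  then have n_big: "4 * b\<^sup>2 / (n * a\<^sup>2) \<le> \<kappa>"
    using n \<kappa> a_pos by (simp add: field_simps)
  show thesis
  proof (rule that[OF m1 \<eta>(1)], unfold halves_within_def, safe)
    fix g \<alpha> e
    assume "\<forall>i<m. a / 2 \<le> \<alpha> i \<and> \<alpha> i \<le> B"
      and "\<forall>i<m. g (Suc i) = g i - (1 / \<alpha> i) *\<^sub>R A (g i) + e i"
      and "\<forall>i<m. norm (e i) \<le> \<eta> * norm (g i)"
      and "\<forall>i. Suc i < m \<longrightarrow> inner (A (g i)) (g i) \<le> (\<alpha> (Suc i) + \<eta>) * (norm (g i))\<^sup>2"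
    then have \<alpha>: "\<And>i. i < m \<Longrightarrow> a / 2 \<le> \<alpha> i \<and> \<alpha> i \<le> B"
      and step: "\<And>i. i < m \<Longrightarrow> g (Suc i) = g i - (1 / \<alpha> i) *\<^sub>R A (g i) + e i"
      and e: "\<And>i. i < m \<Longrightarrow> norm (e i) \<le> \<eta> * norm (g i)"
      and ray: "\<And>i. Suc i < m \<Longrightarrow> inner (A (g i)) (g i) \<le> (\<alpha> (Suc i) + \<eta>) * (norm (g i))\<^sup>2"
      by auto
    show "\<exists>j\<in>{1..m}. norm (g j) \<le> norm (g 0) / 2"
    proof (rule ccontr)
      assume "\<not> ?thesis"
      then have large': "norm (g 0) / 2 < norm (g j)" if "1 \<le> j" "j \<le> m" for j
        using that by (auto simp: not_le)
      define N where "N = (norm (g 0))\<^sup>2"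
      have growth: "(norm (g i))\<^sup>2 \<le> D ^ i * N" if "i \<le> m" for i
        using that
      proof (induction i)
        case (Suc i)
        have "(norm (g (Suc i)))\<^sup>2 \<le> ((2 + 2 * b / a) * norm (g i))\<^sup>2"
          using norm_step_le[of "\<alpha> i" "e i" \<eta> "g i"] \<alpha>[of i] step[of i] e[of i] \<eta>(2) Suc.prems
          by (intro power_mono) auto
        also have "\<dots> = D * (norm (g i))\<^sup>2" by (simp add: D_def power_mult_distrib)
        also have "\<dots> \<le> D * (D ^ i * N)" using Suc D by (intro mult_left_mono) auto
        finally show ?case by simp
      qed (simp add: N_def)
      have "g 0 \<noteq> 0"
      proof
        assume "g 0 = 0"
        then have "(norm (g 1))\<^sup>2 \<le> 0" using growth[OF m1] by (simp add: N_def)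
        with large'[of 1] m1 show False by simp
      qed
      then have N: "N > 0" by (simp add: N_def)
      have large: "N / 4 < (norm (g i))\<^sup>2" if "i \<le> m" for i
      proof (cases "i = 0")
        case True
        then show ?thesis using N by (simp add: N_def)
      next
        case False
        then have "(norm (g 0) / 2)\<^sup>2 < (norm (g i))\<^sup>2"
          using large'[of i] that by (intro power_strict_mono) auto
        then show ?thesis by (simp add: N_def power_divide)
      qed
      have growth_m: "(norm (g i))\<^sup>2 \<le> D ^ m * N" if "i \<le> m" for i
        using growth[OF that] power_increasing[OF that D] N
        by (meson mult_right_mono order_trans less_imp_le)
      have "low_mass n (a * (5 / 4) ^ p) (g i) \<le> N / 32" if "p \<le> P" "T p \<le> i" "i \<le> m" for p i
        using that
      proof (induction p arbitrary: i)
        case 0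
        then show ?case using N by (simp add: low_mass_below)
      next
        case (Suc p)
        define c where "c = a * (5 / 4) ^ p"
        have c: "a \<le> c" using a_pos by (simp add: c_def)
        define f where "f i = low_mass n (5 / 4 * c) (g i)" for i
        define h where "h = (1 - \<rho>) / 64 * N"
        have h0: "0 \<le> h" using \<rho> N by (simp add: h_def)
        have f_step: "f (Suc i) \<le> \<rho> * f i + h" if i: "Suc (T p) \<le> i" "i < m" for i
        proof -
          define w where "w = g (i - 1)"
          have i': "i - 1 \<le> m" "Suc (i - 1) = i" "T p \<le> i - 1" using i by auto
          have w: "N / 4 < (norm w)\<^sup>2" using large[of "i - 1"] i' by (simp add: w_def)
          have w_low: "low_mass n c w \<le> (norm w)\<^sup>2 / 8"
            using Suc.IH[of "i - 1"] Suc.prems(1) i' w by (simp add: w_def c_def)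
          have \<alpha>i: "a / 2 \<le> \<alpha> i" "\<alpha> i \<le> B" using \<alpha> i by auto
          have "f (Suc i) \<le> \<rho> * f i
              + 2 / (1 - \<rho>) * (b\<^sup>2 / (n * (\<alpha> i)\<^sup>2) * (norm (g i))\<^sup>2 + (norm (e i))\<^sup>2)"
            unfolding f_def step[OF i(2)]
            using ray[of "i - 1"] i i' w N \<alpha>i w_low
            by (intro low_mass_next_band[OF n \<rho>_def B c \<eta>(3), of _ w]) (auto simp: w_def)
          also have "\<dots> \<le> \<rho> * f i + 2 / (1 - \<rho>) * (\<kappa> * (D ^ m * N) + \<kappa> * (D ^ m * N))"
          proof (intro add_left_mono mult_left_mono add_mono)
            have "b\<^sup>2 / (n * (\<alpha> i)\<^sup>2) \<le> b\<^sup>2 / (n * (a / 2)\<^sup>2)"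
              using n \<alpha>i a_pos by (intro divide_left_mono mult_left_mono power_mono mult_pos_pos) auto
            also have "\<dots> = 4 * b\<^sup>2 / (n * a\<^sup>2)" by (simp add: power_divide)
            also note n_big
            finally show "b\<^sup>2 / (n * (\<alpha> i)\<^sup>2) * (norm (g i))\<^sup>2 \<le> \<kappa> * (D ^ m * N)"
              using growth_m[of i] i \<kappa> by (intro mult_mono) auto
            have "(norm (e i))\<^sup>2 \<le> (\<eta> * norm (g i))\<^sup>2" using e i by (intro power_mono) auto
            also have "\<dots> \<le> \<kappa> * (D ^ m * N)"
              unfolding power_mult_distrib
              using growth_m[of i] i \<kappa> \<eta>2 by (intro mult_mono) auto
            finally show "(norm (e i))\<^sup>2 \<le> \<kappa> * (D ^ m * N)" .
          qed (use \<rho> in auto)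
          also have "2 / (1 - \<rho>) * (\<kappa> * (D ^ m * N) + \<kappa> * (D ^ m * N)) = h"
            using \<rho> D by (simp add: \<kappa>_def h_def power2_eq_square)
          finally show ?thesis .
        qed
        \<comment> \<open>The contraction starts one step late: the step size refers to the preceding gradient.\<close>
        define t where "t = Suc (T p)"
        define k where "k = i - t"
        have t_le: "t \<le> T (Suc p)" using s(1)[of "T p"] by (simp add: t_def T_Suc)
        have i_eq: "i = t + k" using Suc.prems t_le by (simp add: k_def)
        have "f (t + k) \<le> \<rho> ^ k * f t + h / (1 - \<rho>)"
          using f_step Suc.prems \<rho> h0 by (intro perturbed_contraction) (auto simp: t_def i_eq)
        also have "h / (1 - \<rho>) = N / 64" using \<rho>(2) by (simp add: h_def field_simps)
        also have "\<rho> ^ k * f t \<le> \<rho> ^ (T (Suc p) - t) * (D ^ t * N)"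
        proof (intro mult_mono)
          show "\<rho> ^ k \<le> \<rho> ^ (T (Suc p) - t)"
            using Suc.prems \<rho> by (intro power_decreasing) (auto simp: k_def)
          show "f t \<le> D ^ t * N"
            unfolding f_def using Suc.prems t_le by (intro order_trans[OF low_mass_le growth]) auto
          show "0 \<le> f t"
            unfolding f_def low_mass_def by (intro sum_nonneg mass_nonneg)
        qed (use \<rho> in auto)
        also have "\<dots> \<le> 1 / 64 * N"
          using s(2)[of "T p"] N unfolding t_def T_Suc mult.assoc[symmetric]
          by (intro mult_right_mono) auto
        finally show ?case by (simp add: f_def c_def i_eq mult.left_commute mult.commute)
      qed
      from this[of P m] have "low_mass n (a * (5 / 4) ^ P) (g m) \<le> N / 32"
        by (simp add: m_def)
      moreover have "b < a * (5 / 4) ^ P" using P a_pos by (simp add: field_simps)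
      ultimately have "(norm (g m))\<^sup>2 \<le> N / 32" by (simp add: low_mass_above[OF n])
      with large[of m] N show False by simp
    qed
  qed
qed

end

section \<open>Step sizes and the local R-linear rate\<close>

text \<open>
  Induction over the halving events: between two of them, at most \<open>m\<close> steps apart, the
  sequence grows at most by the factor \<open>C ^ m\<close>. The bound \<open>N\<close> restricts everything to an
  initial segment, so that the estimate can be used while it is still being shown that the
  iterates stay near the critical point.
\<close>

lemma geometric_decay_of_recurrent_halving:
  fixes \<gamma> :: "nat \<Rightarrow> real"
  assumes nonneg: "\<And>k. 0 \<le> \<gamma> k" and C: "1 \<le> C"
    and growth: "\<And>k. 1 \<le> k \<Longrightarrow> k < N \<Longrightarrow> \<gamma> (Suc k) \<le> C * \<gamma> k"
    and halving: "\<And>k. 1 \<le> k \<Longrightarrow> k + m \<le> N \<Longrightarrow> \<exists>j\<in>{1..m}. \<gamma> (k + j) \<le> \<gamma> k / 2"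
    and \<theta>: "0 < \<theta>" "\<theta> < 1" "\<theta> ^ m = 1 / 2"
    and k: "1 \<le> k" "k + n \<le> N"
  shows "\<gamma> (k + n) \<le> 2 * C ^ m * \<theta> ^ n * \<gamma> k"
  using k
proof (induction n arbitrary: k rule: less_induct)
  case (less n)
  have Cm: "1 \<le> C ^ m" using C by (simp add: one_le_power)
  show ?case
  proof (cases "n \<le> m")
    case True
    have "\<gamma> (k + i) \<le> C ^ i * \<gamma> k" if "i \<le> n" for i
      using that
    proof (induction i)
      case (Suc i)
      have "\<gamma> (k + Suc i) \<le> C * \<gamma> (k + i)" using growth[of "k + i"] less.prems Suc.prems by simp
      also have "\<dots> \<le> C * (C ^ i * \<gamma> k)" using Suc C by (intro mult_left_mono) auto
      finally show ?case by simp
    qed simp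
    then have "\<gamma> (k + n) \<le> C ^ n * \<gamma> k" by simp
    also have "\<dots> \<le> C ^ m * \<gamma> k"
      using True C nonneg by (intro mult_right_mono power_increasing)
    also have "\<dots> \<le> C ^ m * (2 * \<theta> ^ n) * \<gamma> k"
    proof -
      have "1 \<le> 2 * \<theta> ^ n" using power_decreasing[OF True, of \<theta>] \<theta> by simp
      then show ?thesis
        using Cm nonneg mult_left_mono[of 1 "2 * \<theta> ^ n" "C ^ m"] by (intro mult_right_mono) auto
    qed
    finally show ?thesis by (simp add: ac_simps)
  next
    case False
    then obtain j where j: "1 \<le> j" "j \<le> m" "\<gamma> (k + j) \<le> \<gamma> k / 2"
      using halving[of k] less.prems by auto
    have "\<gamma> (k + n) = \<gamma> ((k + j) + (n - j))" using j False by simp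
    also have "\<dots> \<le> 2 * C ^ m * \<theta> ^ (n - j) * \<gamma> (k + j)"
      using j False less.prems by (intro less.IH) auto
    also have "\<dots> \<le> 2 * C ^ m * \<theta> ^ (n - j) * (\<gamma> k * \<theta> ^ j)"
    proof (intro mult_left_mono)
      have "1 / 2 \<le> \<theta> ^ j" using power_decreasing[OF j(2), of \<theta>] \<theta> by simp
      then have "\<gamma> k * (1 / 2) \<le> \<gamma> k * \<theta> ^ j" using nonneg by (intro mult_left_mono)
      with j(3) show "\<gamma> (k + j) \<le> \<gamma> k * \<theta> ^ j" by simp
    qed (use \<theta> Cm in auto)
    also have "\<dots> = 2 * C ^ m * (\<theta> ^ (n - j) * \<theta> ^ j) * \<gamma> k" by (simp add: ac_simps)
    also have "\<theta> ^ (n - j) * \<theta> ^ j = \<theta> ^ n"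
      using j False by (simp flip: power_add)
    finally show ?thesis .
  qed
qed

context spectrum_between
begin

text \<open>
  By the Cauchy-Schwarz inequality \<open>bb1\<close> is the smaller of the two step sizes, so the lower bounds
  follow from it and the upper bound from \<open>bb2\<close>.
\<close>

lemma bb_step_size_bounds:
  assumes "x \<noteq> y" and lin: "norm (G y - G x - A (y - x)) \<le> \<eta> * norm (y - x)"
    and \<eta>: "\<eta> \<le> a / 2" and \<alpha>: "\<alpha> \<in> {bb1 G x y, bb2 G x y}"
  shows "a / 2 \<le> \<alpha>" "\<alpha> \<le> 5 * b\<^sup>2 / a"
    "inner (A (y - x)) (y - x) \<le> (\<alpha> + \<eta>) * (norm (y - x))\<^sup>2"
proof -
  define s Y where "s = y - x" and "Y = G y - G x"
  define S where "S = (norm s)\<^sup>2"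
  have S: "0 < S" using assms(1) by (simp add: S_def s_def)
  have dev: "norm (Y - A s) \<le> \<eta> * norm s" using lin by (simp add: s_def Y_def)
  have "\<bar>inner s (Y - A s)\<bar> \<le> norm s * norm (Y - A s)" by (rule Cauchy_Schwarz_ineq2)
  also have "\<dots> \<le> norm s * (\<eta> * norm s)" using dev by (intro mult_left_mono) auto
  also have "\<dots> = \<eta> * S" by (simp add: S_def power2_eq_square)
  finally have sY: "inner (A s) s - \<eta> * S \<le> inner s Y"
    by (simp add: inner_diff_right inner_commute abs_le_iff)
  have "\<eta> * S \<le> a / 2 * S" using \<eta> S by (intro mult_right_mono) auto
  with sY form_ge[of s] have sY_pos: "a / 2 * S \<le> inner s Y"
    by (simp add: S_def)
  have sY0: "0 < inner s Y" using sY_pos mult_pos_pos[of "a / 2" S] S a_pos by linarith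
  have Y_le: "norm Y \<le> 3 / 2 * b * norm s"
  proof -
    have "norm Y \<le> norm (A s) + norm (Y - A s)" using norm_triangle_ineq[of "A s" "Y - A s"] by simp
    also have "\<dots> \<le> b * norm s + b / 2 * norm s"
      using dev norm_A_le[of s] \<eta> a_less_b mult_right_mono[of \<eta> "b / 2" "norm s"] by simp
    finally show ?thesis by simp
  qed
  have bb1: "bb1 G x y = inner s Y / S"
    by (simp add: bb1_def s_def Y_def S_def power2_norm_eq_inner)
  have bb2: "bb2 G x y = (norm Y)\<^sup>2 / inner s Y"
    by (simp add: bb2_def s_def Y_def power2_norm_eq_inner)
  have "(inner s Y)\<^sup>2 \<le> S * (norm Y)\<^sup>2"
    using Cauchy_Schwarz_ineq[of s Y] by (simp add: S_def power2_norm_eq_inner)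
  then have bb_le: "bb1 G x y \<le> bb2 G x y"
    using S sY0 by (simp add: bb1 bb2 field_simps power2_eq_square)
  have "bb2 G x y \<le> (3 / 2 * b * norm s)\<^sup>2 / (a / 2 * S)"
    unfolding bb2 using Y_le sY_pos S a_pos by (intro frac_le power_mono) auto
  also have "\<dots> = 9 / 2 * b\<^sup>2 / a"
    using S a_pos by (simp add: S_def power_mult_distrib power_divide)
  also have "\<dots> \<le> 5 * b\<^sup>2 / a" using a_pos by (intro divide_right_mono) auto
  finally show "\<alpha> \<le> 5 * b\<^sup>2 / a" using \<alpha> bb_le by auto
  have "inner s Y / S \<le> \<alpha>" using \<alpha> bb_le bb1 by auto
  then have \<alpha>S: "inner s Y \<le> \<alpha> * S" using S by (simp add: divide_le_eq)
  show "inner (A (y - x)) (y - x) \<le> (\<alpha> + \<eta>) * (norm (y - x))\<^sup>2"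
    using sY \<alpha>S by (simp add: S_def s_def algebra_simps)
  have "a / 2 * S \<le> \<alpha> * S" using sY_pos \<alpha>S by linarith
  then show "a / 2 \<le> \<alpha>" using S by simp
qed

end

text \<open>
  A run of the method whose first \<open>N + 1\<close> iterates lie where the gradient is almost linear. That
  all iterates do is a consequence of the estimates below, for increasing \<open>N\<close>.
\<close>

locale bb_near_critical_point = spectrum_between A a b
  for A :: "'a::real_inner \<Rightarrow> 'a" and a b :: real +
  fixes G :: "'a \<Rightarrow> 'a" and z :: 'a and u :: "nat \<Rightarrow> 'a" and r \<eta> :: real and N :: nat
  assumes bb: "bb_sequence G u" and start: "u 0 \<noteq> u 1"
    and \<eta>_bounds: "0 < \<eta>" "\<eta> \<le> a / 2"
    and linearization: "x \<in> ball z r \<Longrightarrow> y \<in> ball z r \<Longrightarrow>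
      norm (G x - G y - A (x - y)) \<le> \<eta> * norm (x - y)"
    and near: "i \<le> N \<Longrightarrow> u i \<in> ball z r"
begin

lemma stops:
  assumes "1 \<le> k" "G (u k) = 0"
  shows "u (Suc k) = u k"
  using bb assms by (auto simp: bb_sequence_def)

lemma stays_stopped:
  assumes "1 \<le> k" "G (u k) = 0"
  shows "G (u (k + i)) = 0"
  using assms by (induction i) (auto simp: stops)

lemma step_bounds:
  assumes "1 \<le> k" "k \<le> N" "u (k - 1) \<noteq> u k" "G (u k) \<noteq> 0"
  obtains \<alpha> where "a / 2 \<le> \<alpha>" "\<alpha> \<le> 5 * b\<^sup>2 / a" "u (Suc k) = u k - (1 / \<alpha>) *\<^sub>R G (u k)"
    "inner (A (u k - u (k - 1))) (u k - u (k - 1)) \<le> (\<alpha> + \<eta>) * (norm (u k - u (k - 1)))\<^sup>2"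
proof -
  obtain \<alpha> where \<alpha>: "\<alpha> \<in> {bb1 G (u (k - 1)) (u k), bb2 G (u (k - 1)) (u k)}"
    and step: "u (Suc k) = u k - (1 / \<alpha>) *\<^sub>R G (u k)"
    using bb[unfolded bb_sequence_def, rule_format, OF assms(1)] assms(4) by auto
  have "norm (G (u k) - G (u (k - 1)) - A (u k - u (k - 1))) \<le> \<eta> * norm (u k - u (k - 1))"
    using assms by (intro linearization near) auto
  from bb_step_size_bounds[OF assms(3) this \<eta>_bounds(2) \<alpha>] step show thesis using that by blast
qed

text \<open>
  If two consecutive iterates agreed, both BB step sizes would be \<open>0 / 0 = 0\<close>. By induction this
  cannot happen before the method stops: a step with a positive step size and a nonzero gradient
  moves the iterate.
\<close>

lemma consecutive_distinct:
  assumes "1 \<le> k" "k \<le> N" "G (u k) \<noteq> 0"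
  shows "u (k - 1) \<noteq> u k"
  using assms
proof (induction k rule: nat_induct_at_least)
  case base
  then show ?case using start by simp
next
  case (Suc k)
  have nz: "G (u k) \<noteq> 0" using stops[OF Suc(1)] Suc.prems by auto
  then have "u (k - 1) \<noteq> u k" using Suc by simp
  with nz Suc obtain \<alpha> where "a / 2 \<le> \<alpha>" "u (Suc k) = u k - (1 / \<alpha>) *\<^sub>R G (u k)"
    by (elim step_bounds) auto
  then show ?case using nz a_pos by auto
qed

lemma norm_displacement_le:
  assumes "1 \<le> k" "k \<le> N"
  shows "norm (u (Suc k) - u k) \<le> 2 / a * norm (G (u k))"
proof (cases "G (u k) = 0")
  case True
  then show ?thesis using stops assms by simp
next
  case False
  from step_bounds[OF assms consecutive_distinct[OF assms False] False] obtain \<alpha>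
    where \<alpha>: "a / 2 \<le> \<alpha>" and step: "u (Suc k) = u k - (1 / \<alpha>) *\<^sub>R G (u k)" by metis
  have "1 / \<alpha> \<le> 2 / a" "0 < \<alpha>" using \<alpha> a_pos by (auto simp: field_simps)
  then have "1 / \<alpha> * norm (G (u k)) \<le> 2 / a * norm (G (u k))" by (intro mult_right_mono) auto
  then show ?thesis using \<open>0 < \<alpha>\<close> unfolding step by simp
qed

lemma linearized_step:
  assumes "1 \<le> k" "k < N" "u (Suc k) = u k - (1 / \<alpha>) *\<^sub>R G (u k)" "a / 2 \<le> \<alpha>"
    and e: "e = G (u (Suc k)) - (G (u k) - (1 / \<alpha>) *\<^sub>R A (G (u k)))"
  shows "norm e \<le> 2 * \<eta> / a * norm (G (u k))"
proof -
  have "e = G (u (Suc k)) - G (u k) - A (u (Suc k) - u k)"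
    unfolding e assms(3) by (simp add: linear_neg[OF linear] linear_scale[OF linear])
  then have "norm e \<le> \<eta> * norm (u (Suc k) - u k)"
    using assms(1,2) by (auto intro!: linearization near simp del: mem_ball)
  also have "\<dots> \<le> \<eta> * (2 / a * norm (G (u k)))"
    using \<eta>_bounds norm_displacement_le[of k] assms(1,2) by (intro mult_left_mono) auto
  finally show ?thesis by (simp add: field_simps)
qed

lemma gradient_growth:
  assumes "1 \<le> k" "k < N"
  shows "norm (G (u (Suc k))) \<le> (2 + 2 * b / a) * norm (G (u k))"
proof (cases "G (u k) = 0")
  case True
  then show ?thesis using stops assms by simp
next
  case False
  have k: "k \<le> N" using assms by simp
  from step_bounds[OF assms(1) k consecutive_distinct[OF assms(1) k False] False] obtain \<alpha>
    where \<alpha>: "a / 2 \<le> \<alpha>" and step: "u (Suc k) = u k - (1 / \<alpha>) *\<^sub>R G (u k)" by metis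
  define e where "e = G (u (Suc k)) - (G (u k) - (1 / \<alpha>) *\<^sub>R A (G (u k)))"
  have "norm e \<le> 2 * \<eta> / a * norm (G (u k))"
    by (rule linearized_step[OF assms step \<alpha> e_def])
  from norm_step_le[OF \<alpha> this] show ?thesis
    using \<eta>_bounds a_pos by (simp add: e_def divide_le_eq)
qed

text \<open>
  The displacement before the step \<open>k + i + 1\<close> is a multiple of the gradient at \<open>k + i\<close>, so both
  have the same Rayleigh quotient.
\<close>

lemma gradient_halving:
  assumes halve: "halves_within m \<epsilon> (5 * b\<^sup>2 / a)"
    and m: "1 \<le> m" and \<eta>_le: "\<eta> \<le> \<epsilon>" "2 * \<eta> / a \<le> \<epsilon>" and k: "1 \<le> k" "k + m \<le> N"
  shows "\<exists>j\<in>{1..m}. norm (G (u (k + j))) \<le> norm (G (u k)) / 2"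
proof (cases "G (u (k + m)) = 0")
  case True
  then show ?thesis using m by (intro bexI[of _ m]) auto
next
  case False
  define g where "g i = G (u (k + i))" for i
  have nz: "g i \<noteq> 0" if "i \<le> m" for i
    using stays_stopped[of "k + i" "m - i"] False k that by (auto simp: g_def)
  have "\<exists>\<alpha>. (a / 2 \<le> \<alpha> \<and> \<alpha> \<le> 5 * b\<^sup>2 / a) \<and> u (Suc (k + i)) = u (k + i) - (1 / \<alpha>) *\<^sub>R g i \<and>
      inner (A (u (k + i) - u (k + i - 1))) (u (k + i) - u (k + i - 1))
        \<le> (\<alpha> + \<eta>) * (norm (u (k + i) - u (k + i - 1)))\<^sup>2" if "i < m" for i
  proof -
    have ki: "1 \<le> k + i" "k + i \<le> N" and nzi: "G (u (k + i)) \<noteq> 0"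
      using that k nz[of i] by (auto simp: g_def)
    from step_bounds[OF ki consecutive_distinct[OF ki nzi] nzi] show ?thesis unfolding g_def by metis
  qed
  then obtain \<alpha> where \<alpha>: "\<And>i. i < m \<Longrightarrow> a / 2 \<le> \<alpha> i \<and> \<alpha> i \<le> 5 * b\<^sup>2 / a"
    and step: "\<And>i. i < m \<Longrightarrow> u (Suc (k + i)) = u (k + i) - (1 / \<alpha> i) *\<^sub>R g i"
    and ray: "\<And>i. i < m \<Longrightarrow> inner (A (u (k + i) - u (k + i - 1))) (u (k + i) - u (k + i - 1))
        \<le> (\<alpha> i + \<eta>) * (norm (u (k + i) - u (k + i - 1)))\<^sup>2"
    by metis
  define e where "e i = g (Suc i) - (g i - (1 / \<alpha> i) *\<^sub>R A (g i))" for i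
  have "\<exists>j\<in>{1..m}. norm (g j) \<le> norm (g 0) / 2"
  proof (rule halve[unfolded halves_within_def, rule_format, of \<alpha> g e],
      intro conjI allI impI)
    fix i assume i: "i < m"
    show "a / 2 \<le> \<alpha> i" "\<alpha> i \<le> 5 * b\<^sup>2 / a" using \<alpha>[OF i] by auto
    show "g (Suc i) = g i - (1 / \<alpha> i) *\<^sub>R A (g i) + e i" by (simp add: e_def)
    have "norm (e i) \<le> 2 * \<eta> / a * norm (g i)"
      using linearized_step[of "k + i" "\<alpha> i" "e i"] step[OF i] \<alpha>[OF i] i k
      by (simp add: g_def e_def)
    also have "\<dots> \<le> \<epsilon> * norm (g i)" using \<eta>_le by (intro mult_right_mono) auto
    finally show "norm (e i) \<le> \<epsilon> * norm (g i)" .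
  next
    fix i assume i: "Suc i < m"
    define \<beta> where "\<beta> = - (1 / \<alpha> i)"
    have "\<alpha> i \<noteq> 0" using \<alpha>[of i] i a_pos by auto
    then have \<beta>: "\<beta>\<^sup>2 > 0" by (simp add: \<beta>_def)
    have s: "u (k + Suc i) - u (k + Suc i - 1) = \<beta> *\<^sub>R g i"
      using step[of i] i by (simp add: \<beta>_def)
    have "\<beta>\<^sup>2 * inner (A (g i)) (g i) \<le> \<beta>\<^sup>2 * ((\<alpha> (Suc i) + \<eta>) * (norm (g i))\<^sup>2)"
      using ray[OF i] unfolding s
      by (simp add: linear_scale[OF linear] power_mult_distrib power2_eq_square ac_simps)
    then have "inner (A (g i)) (g i) \<le> (\<alpha> (Suc i) + \<eta>) * (norm (g i))\<^sup>2"
      using \<beta> by simp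
    also have "\<dots> \<le> (\<alpha> (Suc i) + \<epsilon>) * (norm (g i))\<^sup>2"
      using \<eta>_le by (intro mult_right_mono) auto
    finally show "inner (A (g i)) (g i) \<le> (\<alpha> (Suc i) + \<epsilon>) * (norm (g i))\<^sup>2" .
  qed
  then show ?thesis by (simp add: g_def)
qed

end

context spectrum_between
begin

lemma norm_near_zero:
  assumes lin: "norm (G x - G z - A (x - z)) \<le> \<eta> * norm (x - z)" and "G z = 0" and \<eta>: "\<eta> \<le> a / 2"
  shows "a / 2 * norm (x - z) \<le> norm (G x)" "norm (G x) \<le> 2 * b * norm (x - z)"
proof -
  define d where "d = x - z"
  have dev: "norm (G x - A d) \<le> a / 2 * norm d"
    using lin assms(2) \<eta> mult_right_mono[of \<eta> "a / 2" "norm d"] by (simp add: d_def)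
  have "a * norm d \<le> norm (A d)"
  proof (cases "d = 0")
    case False
    have "a * (norm d)\<^sup>2 \<le> norm (A d) * norm d"
      using form_ge[of d] norm_cauchy_schwarz[of "A d" d] by linarith
    then show ?thesis using False by (simp add: power2_eq_square)
  qed simp
  with dev norm_triangle_ineq2[of "A d" "A d - G x"] show "a / 2 * norm (x - z) \<le> norm (G x)"
    by (simp add: d_def norm_minus_commute)
  have "a / 2 * norm d \<le> b * norm d" using a_pos a_less_b by (intro mult_right_mono) auto
  with dev norm_A_le[of d] norm_triangle_ineq[of "A d" "G x - A d"]
  show "norm (G x) \<le> 2 * b * norm (x - z)" by (simp add: d_def)
qed

text \<open>
  Since \<open>norm (G x)\<close> and \<open>norm (x - z)\<close> are equivalent near \<open>z\<close>, the decay of the gradients gives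
  both rates. It also keeps the iterates near \<open>z\<close>: if it holds up to some index, the next
  displacement is bounded by a multiple of \<open>\<zeta>\<close>.
\<close>

theorem bb_R_linear:
  assumes strict: "\<And>\<eta>. 0 < \<eta> \<Longrightarrow> \<exists>r>0. \<forall>x\<in>ball z r. \<forall>y\<in>ball z r.
      norm (G x - G y - A (x - y)) \<le> \<eta> * norm (x - y)"
    and zero: "G z = 0"
  shows "\<exists>\<zeta> lam1 lam2 \<theta> :: real. 0 < \<zeta> \<and> 0 < lam1 \<and> 0 < lam2 \<and> 0 < \<theta> \<and> \<theta> < 1 \<and>
    (\<forall>u. bb_sequence G u \<and> u 0 \<in> ball z \<zeta> \<and> u 1 \<in> ball z \<zeta> \<and> u 0 \<noteq> u 1 \<longrightarrow>
       (\<forall>k\<ge>1. norm (u k - z) \<le> lam1 * \<theta> ^ k * norm (u 1 - z)) \<and>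
       (\<forall>k\<ge>1. norm (G (u k)) \<le> lam2 * \<theta> ^ k * norm (G (u 1))))"
proof -
  have b: "0 < b" using a_pos a_less_b by simp
  have "2 * a * a \<le> 5 * b\<^sup>2"
    using mult_mono[of a b a b] a_pos a_less_b zero_le_square[of b]
    unfolding power2_eq_square by linarith
  then have B: "2 * a \<le> 5 * b\<^sup>2 / a" using a_pos by (simp add: le_divide_eq)
  from perturbed_bb_halving[OF B] obtain m \<epsilon> where m: "m \<ge> 1" and \<epsilon>: "\<epsilon> > 0"
    and halve: "halves_within m \<epsilon> (5 * b\<^sup>2 / a)"
    by metis
  define \<eta> where "\<eta> = Min {a / 2, \<epsilon>, a * \<epsilon> / 2}"
  have \<eta>: "0 < \<eta>" "\<eta> \<le> a / 2" "\<eta> \<le> \<epsilon>" "\<eta> \<le> a * \<epsilon> / 2"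
    using a_pos \<epsilon> by (auto simp: \<eta>_def)
  then have \<eta>': "2 * \<eta> / a \<le> \<epsilon>" using a_pos by (simp add: field_simps)
  obtain r where r: "r > 0" and lin: "\<And>x y. x \<in> ball z r \<Longrightarrow> y \<in> ball z r \<Longrightarrow>
      norm (G x - G y - A (x - y)) \<le> \<eta> * norm (x - y)"
    using strict[OF \<eta>(1)] by blast
  define C where "C = 2 + 2 * b / a"
  have C: "1 \<le> C" using a_pos b by (simp add: C_def)
  define \<theta> where "\<theta> = root m (1 / 2)"
  have \<theta>: "0 < \<theta>" "\<theta> < 1" "\<theta> ^ m = 1 / 2"
    using m by (simp_all add: \<theta>_def real_root_pow_pos2)
  define K where "K = 2 * C ^ m"
  have K: "1 \<le> K" using one_le_power[OF C, of m] unfolding K_def by linarith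
  define \<zeta> where "\<zeta> = min r (r * a / (8 * b * K))"
  have \<zeta>: "0 < \<zeta>" "\<zeta> \<le> r" "8 * b * K * \<zeta> / a \<le> r"
  proof -
    show "0 < \<zeta>" "\<zeta> \<le> r" using r a_pos b K by (auto simp: \<zeta>_def)
    have "\<zeta> \<le> r * a / (8 * b * K)" by (simp add: \<zeta>_def)
    then show "8 * b * K * \<zeta> / a \<le> r" using a_pos b K by (simp add: field_simps)
  qed
  have size: "a / 2 * norm (x - z) \<le> norm (G x)" "norm (G x) \<le> 2 * b * norm (x - z)"
    if "x \<in> ball z r" for x
    using norm_near_zero[OF lin[of x z] zero \<eta>(2)] that r by auto
  have main: "u k \<in> ball z r \<and> norm (G (u k)) \<le> K * \<theta> ^ (k - 1) * norm (G (u 1))"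
    if bb: "bb_sequence G u" and u01: "u 0 \<in> ball z \<zeta>" "u 1 \<in> ball z \<zeta>" "u 0 \<noteq> u 1"
      and "1 \<le> k" for u k
  proof -
    have decay: "norm (G (u (1 + n))) \<le> K * \<theta> ^ n * norm (G (u 1))"
      if near: "\<And>i. i \<le> Suc n \<Longrightarrow> u i \<in> ball z r" for n
    proof -
      interpret bb_near_critical_point A a b G z u r \<eta> "Suc n"
        by unfold_locales (use bb u01 \<eta> lin near in auto)
      show ?thesis
        unfolding K_def C_def
        using gradient_growth gradient_halving[OF halve m \<eta>(3) \<eta>'] C \<theta>
        by (intro geometric_decay_of_recurrent_halving[where N = "Suc n"]) (auto simp: C_def)
    qed
    have near: "\<forall>i\<le>Suc n. u i \<in> ball z r" for n
    proof (induction n)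
      case 0
      then show ?case using u01 \<zeta>(2) by (auto simp: le_Suc_eq)
    next
      case (Suc n)
      interpret bb_near_critical_point A a b G z u r \<eta> "Suc n"
        by unfold_locales (use bb u01 \<eta> lin Suc in auto)
      have un: "u (Suc n) \<in> ball z r" and u1: "u 1 \<in> ball z r" using Suc by auto
      have "norm (G (u (Suc n))) \<le> K * \<theta> ^ n * norm (G (u 1))" using decay[of n] Suc by simp
      also have "\<dots> \<le> K * 1 * (2 * b * norm (u 1 - z))"
        using size(2)[OF u1] K \<theta> b by (intro mult_mono power_le_one) auto
      also have "\<dots> < K * 1 * (2 * b * \<zeta>)"
        using u01(2) K b by (simp add: dist_norm norm_minus_commute)
      finally have Gn: "norm (G (u (Suc n))) < 2 * b * K * \<zeta>" by (simp add: ac_simps)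
      have "norm (u (Suc (Suc n)) - z) \<le> norm (u (Suc (Suc n)) - u (Suc n)) + norm (u (Suc n) - z)"
        using norm_triangle_ineq[of "u (Suc (Suc n)) - u (Suc n)" "u (Suc n) - z"] by simp
      also have "\<dots> \<le> 2 / a * norm (G (u (Suc n))) + 2 / a * norm (G (u (Suc n)))"
        using norm_displacement_le[of "Suc n"] size(1)[OF un] a_pos
        by (intro add_mono) (auto simp: field_simps)
      also have "\<dots> < 4 / a * (2 * b * K * \<zeta>)"
        using mult_strict_left_mono[OF Gn, of "4 / a"] a_pos by simp
      also have "\<dots> \<le> r" using \<zeta>(3) by simp
      finally have "u (Suc (Suc n)) \<in> ball z r" by (simp add: dist_norm norm_minus_commute)
      with Suc show ?case by (auto simp: le_Suc_eq)
    qed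
    have "u i \<in> ball z r" for i using near[of i] by auto
    then show ?thesis using decay[of "k - 1"] \<open>1 \<le> k\<close> by auto
  qed
  define lam2 where "lam2 = K / \<theta>"
  define lam1 where "lam1 = 4 * b / a * lam2"
  have lam: "0 < lam1" "0 < lam2" using K \<theta> a_pos b by (auto simp: lam1_def lam2_def)
  have grad: "norm (G (u k)) \<le> lam2 * \<theta> ^ k * norm (G (u 1))"
    if "bb_sequence G u \<and> u 0 \<in> ball z \<zeta> \<and> u 1 \<in> ball z \<zeta> \<and> u 0 \<noteq> u 1" "1 \<le> k" for u k
  proof -
    have "K * \<theta> ^ (k - 1) = lam2 * \<theta> ^ k"
      using \<open>1 \<le> k\<close> \<theta> by (cases k) (auto simp: lam2_def)
    then show ?thesis using main[of u k] that by auto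
  qed
  have err: "norm (u k - z) \<le> lam1 * \<theta> ^ k * norm (u 1 - z)"
    if u: "bb_sequence G u \<and> u 0 \<in> ball z \<zeta> \<and> u 1 \<in> ball z \<zeta> \<and> u 0 \<noteq> u 1" and k: "1 \<le> k" for u k
  proof -
    have near: "u k \<in> ball z r" "u 1 \<in> ball z r" using main[of u k, THEN conjunct1] main[of u 1, THEN conjunct1] u k by blast+
    have "norm (u k - z) \<le> 2 / a * norm (G (u k))"
      using size(1)[OF near(1)] a_pos by (simp add: field_simps)
    also have "\<dots> \<le> 2 / a * (lam2 * \<theta> ^ k * (2 * b * norm (u 1 - z)))"
      using size(2)[OF near(2)] lam \<theta> a_pos
      by (intro mult_left_mono order_trans[OF grad[OF u k]]) auto
    finally show ?thesis by (simp add: lam1_def ac_simps)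
  qed
  show ?thesis
  proof (rule exI[of _ \<zeta>], rule exI[of _ lam1], rule exI[of _ lam2], rule exI[of _ \<theta>],
      intro conjI allI impI)
  qed (fact \<zeta>(1) lam \<theta>(1,2) err grad)+
qed

end

section \<open>The gradient near a minimizer\<close>

lemma strict_differentiability:
  fixes f :: "'a::real_normed_vector \<Rightarrow> 'b::real_normed_vector"
  assumes deriv: "\<And>x. (f has_derivative blinfun_apply (f' x)) (at x)"
    and cont: "isCont f' z" and "0 < \<eta>"
  obtains r where "r > 0" "\<And>x y. x \<in> ball z r \<Longrightarrow> y \<in> ball z r \<Longrightarrow>
    norm (f x - f y - f' z (x - y)) \<le> \<eta> * norm (x - y)"
proof -
  obtain r where r: "r > 0" "\<And>x. dist x z < r \<Longrightarrow> dist (f' x) (f' z) < \<eta>"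
    using cont \<open>0 < \<eta>\<close> unfolding continuous_at_eps_delta by (metis dist_commute)
  show thesis
  proof (rule that[OF r(1)])
    fix x y assume xy: "x \<in> ball z r" "y \<in> ball z r"
    have "norm (f x - f y - f' z (x - y)) \<le> norm (x - y) * \<eta>"
    proof (rule differentiable_bound_linearization[where S = "ball z r" and f' = "\<lambda>x. blinfun_apply (f' x)"])
      fix t :: real assume "t \<in> {0..1}"
      then have "(1 - t) *\<^sub>R y + t *\<^sub>R x \<in> ball z r"
        using xy convex_ball[of z r] by (auto simp: convex_alt simp del: mem_ball)
      then show "y + t *\<^sub>R (x - y) \<in> ball z r" by (simp add: algebra_simps)
    next
      fix w assume "w \<in> ball z r"
      then have "norm (f' w - f' z) \<le> \<eta>" using r(2)[of w] by (simp add: dist_commute dist_norm norm_minus_commute)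
      then show "onorm (blinfun_apply (f' w) - blinfun_apply (f' z)) \<le> \<eta>"
        by (simp add: norm_blinfun.rep_eq minus_blinfun.rep_eq fun_diff_def)
    qed (use r(1) deriv in \<open>auto intro: has_derivative_at_withinI\<close>)
    then show "norm (f x - f y - f' z (x - y)) \<le> \<eta> * norm (x - y)" by (simp add: mult.commute)
  qed
qed

text \<open>
  The second difference is symmetric in \<open>v\<close> and \<open>w\<close>. The mean value theorem along \<open>v\<close> turns it into
  a difference of first derivatives in direction \<open>w\<close>.
\<close>

lemma second_difference_estimate:
  fixes F :: "'a::real_normed_vector \<Rightarrow> real" and F' :: "'a \<Rightarrow> 'a \<Rightarrow>\<^sub>L real"
    and H :: "'a \<Rightarrow>\<^sub>L 'a \<Rightarrow>\<^sub>L real"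
  assumes deriv: "\<And>x. (F has_derivative blinfun_apply (F' x)) (at x)"
    and strict: "\<And>x y. x \<in> ball z r \<Longrightarrow> y \<in> ball z r \<Longrightarrow>
      norm (F' x - F' y - H (x - y)) \<le> \<eta> * norm (x - y)"
    and s: "0 < s" "s * (norm v + norm w) < r"
  shows "\<bar>F (z + s *\<^sub>R v + s *\<^sub>R w) - F (z + s *\<^sub>R v) - F (z + s *\<^sub>R w) + F z
      - s * blinfun_apply (blinfun_apply H (s *\<^sub>R w)) v\<bar> \<le> s\<^sup>2 * (\<eta> * (norm v * norm w))"
proof -
  define \<phi> where "\<phi> t = F (z + t *\<^sub>R v + s *\<^sub>R w) - F (z + t *\<^sub>R v)" for t
  define \<phi>' where "\<phi>' t = blinfun_apply (F' (z + t *\<^sub>R v + s *\<^sub>R w) - F' (z + t *\<^sub>R v)) v" for t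
  have along: "((\<lambda>t. F (c + t *\<^sub>R v)) has_derivative (\<lambda>h. h * blinfun_apply (F' (c + t *\<^sub>R v)) v)) (at t)"
    for c and t :: real
  proof -
    have "((\<lambda>t. c + t *\<^sub>R v) has_derivative (\<lambda>h. h *\<^sub>R v)) (at t)"
      by (auto intro!: derivative_eq_intros)
    from has_derivative_compose[OF this deriv] show ?thesis by (simp add: blinfun.scaleR_right)
  qed
  have d\<phi>: "(\<phi> has_derivative (\<lambda>h. h * \<phi>' t)) (at t)" for t
    using has_derivative_diff[OF along[of "z + s *\<^sub>R w" t] along[of z t]]
    unfolding \<phi>_def \<phi>'_def by (simp add: ac_simps blinfun.diff_left right_diff_distrib)
  have "\<exists>t\<in>{0<..<s}. \<phi> s - \<phi> 0 = (s - 0) * \<phi>' t"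
    using s(1) by (rule mvt_simple) (rule has_derivative_at_withinI[OF d\<phi>])
  then obtain t where t: "0 < t" "t < s" "\<phi> s - \<phi> 0 = s * \<phi>' t" by auto
  define p q where "p = z + t *\<^sub>R v + s *\<^sub>R w" and "q = z + t *\<^sub>R v"
  have tv: "t * norm v \<le> s * norm v" using t by (intro mult_right_mono) auto
  have "norm (t *\<^sub>R v + s *\<^sub>R w) \<le> t * norm v + s * norm w"
    using norm_triangle_ineq[of "t *\<^sub>R v" "s *\<^sub>R w"] t s(1) by simp
  then have "norm (t *\<^sub>R v + s *\<^sub>R w) < r" using tv s(2) by (simp add: distrib_left)
  moreover have "norm (t *\<^sub>R v) < r"
    using tv s t by (simp add: distrib_left) (smt (verit) mult_nonneg_nonneg norm_ge_zero)
  moreover have dist_add: "dist z (z + x) = norm x" for x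
    by (simp add: dist_norm norm_minus_commute[of z])
  moreover have "dist z p = norm (t *\<^sub>R v + s *\<^sub>R w)" "dist z q = norm (t *\<^sub>R v)"
    using dist_add unfolding p_def q_def add.assoc by blast+
  ultimately have pq: "p \<in> ball z r" "q \<in> ball z r" by simp_all
  have "\<bar>blinfun_apply (F' p - F' q - H (p - q)) v\<bar> \<le> norm (F' p - F' q - H (p - q)) * norm v"
    using norm_blinfun[of "F' p - F' q - H (p - q)" v] by simp
  also have "\<dots> \<le> \<eta> * norm (p - q) * norm v"
    using strict[OF pq] by (intro mult_right_mono) auto
  finally have est: "\<bar>\<phi>' t - blinfun_apply (H (s *\<^sub>R w)) v\<bar> \<le> \<eta> * (s * norm w) * norm v"
    using s(1) by (simp add: p_def q_def \<phi>'_def blinfun.diff_left)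
  have "\<bar>s * \<phi>' t - s * blinfun_apply (H (s *\<^sub>R w)) v\<bar> = s * \<bar>\<phi>' t - blinfun_apply (H (s *\<^sub>R w)) v\<bar>"
    using s(1) by (simp add: abs_mult flip: right_diff_distrib)
  also have "\<dots> \<le> s * (\<eta> * (s * norm w) * norm v)" using est s(1) by (intro mult_left_mono) auto
  also have "s * \<phi>' t = F (z + s *\<^sub>R v + s *\<^sub>R w) - F (z + s *\<^sub>R v) - F (z + s *\<^sub>R w) + F z"
    using t(3) by (simp add: \<phi>_def)
  finally show ?thesis by (simp add: power2_eq_square ac_simps)
qed

text \<open>This makes the operator of the Hessian self-adjoint.\<close>

lemma second_derivative_symmetric:
  fixes F :: "'a::real_normed_vector \<Rightarrow> real" and F' :: "'a \<Rightarrow> 'a \<Rightarrow>\<^sub>L real"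
  assumes d1: "\<And>x. (F has_derivative blinfun_apply (F' x)) (at x)"
    and d2: "\<And>x. (F' has_derivative blinfun_apply (F'' x)) (at x)"
    and cont: "isCont F'' z"
  shows "blinfun_apply (blinfun_apply (F'' z) v) w = blinfun_apply (blinfun_apply (F'' z) w) v"
proof (rule ccontr)
  let ?H = "\<lambda>v w. blinfun_apply (blinfun_apply (F'' z) v) w"
  assume neq: "?H v w \<noteq> ?H w v"
  define M where "M = 2 * (norm v * norm w) + 1"
  have M: "M > 0" by (simp add: M_def add_nonneg_pos)
  define \<eta> where "\<eta> = \<bar>?H v w - ?H w v\<bar> / M"
  have \<eta>: "\<eta> > 0" using neq M by (simp add: \<eta>_def)
  from strict_differentiability[OF d2 cont \<eta>] obtain r where r: "r > 0"
    and strict: "\<And>x y. x \<in> ball z r \<Longrightarrow> y \<in> ball z r \<Longrightarrow>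
      norm (F' x - F' y - blinfun_apply (F'' z) (x - y)) \<le> \<eta> * norm (x - y)" by metis
  define s where "s = r / (2 * (norm v + norm w + 1))"
  have pos: "0 < norm v + norm w + 1" by (simp add: add_nonneg_pos)
  have s: "0 < s" using r pos by (simp add: s_def)
  have "s * (norm v + norm w) < s * (2 * (norm v + norm w + 1))"
    using s pos by (intro mult_strict_left_mono) auto
  also have "\<dots> = r" using pos by (simp add: s_def)
  finally have small: "s * (norm v + norm w) < r" .
  then have small': "s * (norm w + norm v) < r" by (simp add: add.commute)
  define \<Delta> where "\<Delta> = F (z + s *\<^sub>R v + s *\<^sub>R w) - F (z + s *\<^sub>R v) - F (z + s *\<^sub>R w) + F z"
  have est: "\<bar>F (z + s *\<^sub>R v + s *\<^sub>R w) - F (z + s *\<^sub>R v) - F (z + s *\<^sub>R w) + F z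
      - s * ?H (s *\<^sub>R w) v\<bar> \<le> s\<^sup>2 * (\<eta> * (norm v * norm w))"
    if "s * (norm v + norm w) < r" for v w
    by (rule second_difference_estimate[OF d1 _ s that]) (rule strict)
  have "\<bar>\<Delta> - s\<^sup>2 * ?H w v\<bar> \<le> s\<^sup>2 * (\<eta> * (norm v * norm w))"
    using est[OF small]
    by (simp add: \<Delta>_def blinfun.scaleR_right blinfun.scaleR_left power2_eq_square mult.assoc)
  moreover have "\<bar>\<Delta> - s\<^sup>2 * ?H v w\<bar> \<le> s\<^sup>2 * (\<eta> * (norm v * norm w))"
    using est[OF small']
    by (simp add: \<Delta>_def blinfun.scaleR_right blinfun.scaleR_left power2_eq_square algebra_simps)
  ultimately have "\<bar>s\<^sup>2 * ?H v w - s\<^sup>2 * ?H w v\<bar> \<le> s\<^sup>2 * (\<eta> * (M - 1))"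
    by (simp add: M_def algebra_simps abs_le_iff)
  then have "s\<^sup>2 * \<bar>?H v w - ?H w v\<bar> \<le> s\<^sup>2 * (\<eta> * (M - 1))"
    by (simp add: abs_mult flip: right_diff_distrib)
  then have "\<bar>?H v w - ?H w v\<bar> \<le> \<eta> * (M - 1)" using s by simp
  then have "\<eta> * M \<le> \<eta> * (M - 1)" using M by (simp add: \<eta>_def)
  then show False using \<eta> by (simp add: algebra_simps)
qed

theorem theorem3:
  fixes F :: "'a::{real_inner, complete_space} \<Rightarrow> real"
    and F' :: "'a \<Rightarrow> 'a \<Rightarrow>\<^sub>L real"
    and F'' :: "'a \<Rightarrow> 'a \<Rightarrow>\<^sub>L ('a \<Rightarrow>\<^sub>L real)"
    and ustar :: 'a
    and \<delta>_inf \<delta>_sup :: real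
  assumes deriv1: "\<And>u. (F has_derivative blinfun_apply (F' u)) (at u)"
    and deriv2: "\<And>u. (F' has_derivative blinfun_apply (F'' u)) (at u)"
    and deriv2_cont: "continuous_on UNIV F''"
    and deriv2_lipschitz: "locally_lipschitz F''"
    and local_min: "local_minimizer F ustar"
    and delta: "0 < \<delta>_inf" "\<delta>_inf \<le> \<delta>_sup"
    and lower: "\<And>v. \<delta>_inf * (norm v)\<^sup>2 \<le> blinfun_apply (blinfun_apply (F'' ustar) v) v"
    and upper: "\<And>v. blinfun_apply (blinfun_apply (F'' ustar) v) v \<le> \<delta>_sup * (norm v)\<^sup>2"
  shows "\<exists>\<zeta> lam1 lam2 \<theta> :: real. 0 < \<zeta> \<and> 0 < lam1 \<and> 0 < lam2 \<and> 0 < \<theta> \<and> \<theta> < 1 \<and>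
    (\<forall>u :: nat \<Rightarrow> 'a.
       bb_sequence (gradient F) u \<and> u 0 \<in> ball ustar \<zeta> \<and> u 1 \<in> ball ustar \<zeta> \<and> u 0 \<noteq> u 1 \<longrightarrow>
       (\<forall>k\<ge>1. norm (u k - ustar) \<le> lam1 * \<theta> ^ k * norm (u 1 - ustar)) \<and>
       (\<forall>k\<ge>1. norm (gradient F (u k)) \<le> lam2 * \<theta> ^ k * norm (gradient F (u 1))))"
proof -
  define G where "G = gradient F"
  have G: "blinfun_apply (F' x) h = inner h (G x)" for x h
  proof -
    have "GDERIV F x :> G x"
      unfolding G_def using deriv1 by (intro GDERIV_gradient) (auto simp: differentiable_def)
    then have "blinfun_apply (F' x) = (\<lambda>h. inner h (G x))"
      unfolding gderiv_def by (rule has_derivative_unique[OF deriv1])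
    then show ?thesis by simp
  qed
  have "\<exists>g. \<forall>h. blinfun_apply (blinfun_apply (F'' ustar) v) h = inner h g" for v
    by (intro riesz_representation blinfun.bounded_linear_right)
  then obtain A where A: "\<And>v h. blinfun_apply (blinfun_apply (F'' ustar) v) h = inner h (A v)"
    by metis
  have cont: "isCont F'' ustar"
    using deriv2_cont by (simp add: continuous_on_eq_continuous_at)
  have sym: "inner w (A v) = inner v (A w)" for v w
    using second_derivative_symmetric[OF deriv1 deriv2 cont, of v w] by (simp add: A)
  have A_eqI: "A v = w" if "\<And>h. inner h (A v) = inner h w" for v w
    using that by (metis inner_commute vector_eq_rdot)
  \<comment> \<open>Adding 1 keeps the interval nondegenerate when \<open>\<delta>_inf = \<delta>_sup\<close>.\<close>
  interpret spectrum_between A \<delta>_inf "\<delta>_sup + 1"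
  proof
    show "A (x + y) = A x + A y" for x y
      by (rule A_eqI) (simp add: inner_add_right blinfun.add_right blinfun.add_left flip: A)
    show "A (c *\<^sub>R x) = c *\<^sub>R A x" for c x
      by (rule A_eqI) (simp add: blinfun.scaleR_right blinfun.scaleR_left flip: A)
    show "inner (A v) w = inner v (A w)" for v w
      using sym[of w v] by (simp add: inner_commute)
    show "\<delta>_inf * (norm v)\<^sup>2 \<le> inner (A v) v" for v
      using lower[of v] by (simp add: A inner_commute)
    show "inner (A v) v \<le> (\<delta>_sup + 1) * (norm v)\<^sup>2" for v
      using upper[of v] by (simp add: A inner_commute distrib_right add_increasing2)
  qed (use delta in auto)
  show ?thesis
    unfolding G_def[symmetric]
  proof (rule bb_R_linear)
    obtain \<rho> where "\<rho> > 0" "\<forall>y\<in>ball ustar \<rho>. F ustar \<le> F y"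
      using local_min by (auto simp: local_minimizer_def)
    then have "blinfun_apply (F' ustar) = (\<lambda>v. 0)"
      by (intro differential_zero_maxmin[of ustar "ball ustar \<rho>" F] deriv1) auto
    then show "G ustar = 0" using G[of ustar "G ustar"] by simp
  next
    fix \<eta> :: real assume "0 < \<eta>"
    from strict_differentiability[OF deriv2 cont this] obtain r where r: "r > 0"
      and lin: "\<And>x y. x \<in> ball ustar r \<Longrightarrow> y \<in> ball ustar r \<Longrightarrow>
        norm (F' x - F' y - blinfun_apply (F'' ustar) (x - y)) \<le> \<eta> * norm (x - y)" by metis
    have "norm (G x - G y - A (x - y)) \<le> \<eta> * norm (x - y)"
      if xy: "x \<in> ball ustar r" "y \<in> ball ustar r" for x y
    proof -
      define T where "T = F' x - F' y - blinfun_apply (F'' ustar) (x - y)"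
      define d where "d = G x - G y - A (x - y)"
      have "norm d * norm d = inner d d"
        by (simp add: dot_square_norm power2_eq_square)
      also have "\<dots> = blinfun_apply T d"
        by (simp add: T_def blinfun.diff_left G A inner_diff_right)
          (simp add: d_def flip: inner_diff_right)
      also have "\<dots> \<le> norm T * norm d" using norm_blinfun[of T d] by simp
      finally have "norm d \<le> norm T"
        by (cases "d = 0") auto
      with lin[OF xy] show ?thesis by (simp add: T_def d_def)
    qed
    with r show "\<exists>r>0. \<forall>x\<in>ball ustar r. \<forall>y\<in>ball ustar r.
        norm (G x - G y - A (x - y)) \<le> \<eta> * norm (x - y)" by blast
  qed
qed

end
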